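(* There is a one-sided property testing algorithm for $k$-vertex connectivity of directed graphs with false-reject probability at most $\tfrac13$ that performs $O\big(\tfrac{k^5}{(\epsilon\overline d)^2}\log(\tfrac{k}{\epsilon\overline d})\big)$ many queries in unbounded-degree graphs and $O\big(\tfrac{k^3}{\epsilon}(\log(\tfrac{k}{\epsilon d}))^2\big)$ many queries in bounded-degree graphs.
   Context: $G=(V,E)$ is a directed graph with $n$ vertices and $m$ edges; $\overline d=m/n$. Queries are incidence-list queries: the $i$-th outgoing or $i$-th incoming edge of a vertex ($\bot$ if none). A graph is $k$-vertex connected if it has more than $k$ vertices and is strongly connected whenever fewer than $k$ vertices are removed. Unbounded-degree model: $\epsilon$-far means more than $\epsilon n\overline d$ edge modifications are needed to obtain the property. Bounded-degree model: $d$ is a given upper bound on every vertex's in- and out-degree, and $\epsilon$-far means more than $\epsilon nd$ edge modifications are needed. A property testing algorithm knows $n$ and $d$ or $\overline d$ (and $m$), is given $\epsilon,k$, and with probability at least $\tfrac23$ accepts graphs with the property and rejects graphs $\epsilon$-far from it; one-sided means graphs with the property are always accepted. *)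

theory Defs
  imports "HOL-Probability.Probability" "Graph_Theory.Graph_Theory"
begin

section \<open>Vertex connectivity and distance\<close>

definition k_vertex_connected :: "nat \<Rightarrow> 'a pair_pre_digraph \<Rightarrow> bool" where
  "k_vertex_connected k G \<longleftrightarrow>
     card (pverts G) > k \<and>
     (\<forall>S \<subseteq> pverts G. card S < k \<longrightarrow>
        strongly_connected (induce_subgraph (with_proj G) (pverts G - S)))"

text \<open>An edge modification is the insertion or the deletion of one edge, so the number of
  modifications leading from G to H is the size of the symmetric difference of their edge sets.\<close>

definition modifications :: "'a pair_pre_digraph \<Rightarrow> 'a pair_pre_digraph \<Rightarrow> nat" where
  "modifications G H = card ((parcs G - parcs H) \<union> (parcs H - parcs G))"

text \<open>More than t modifications are needed to make G have property P. If no graph on the vertex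
  set of G has P, this holds for every t. The modified graph H is subject to no degree bound.\<close>

definition needs_more_modifications ::
  "('a pair_pre_digraph \<Rightarrow> bool) \<Rightarrow> real \<Rightarrow> 'a pair_pre_digraph \<Rightarrow> bool" where
  "needs_more_modifications P t G \<longleftrightarrow>
     (\<forall>H. pair_digraph H \<and> pverts H = pverts G \<and> P H \<longrightarrow> real (modifications G H) > t)"

section \<open>Incidence-list queries\<close>

text \<open>Positions in incidence lists are counted from 0; \<open>None\<close> plays the role of the answer
  \<open>\<bottom>\<close>.\<close>

datatype query = Out_Edge nat nat | In_Edge nat nat

type_synonym answer = "(nat \<times> nat) option"

definition entry :: "'b list \<Rightarrow> nat \<Rightarrow> 'b option" where
  "entry xs i = (if i < length xs then Some (xs ! i) else None)"

text \<open>The lists may enumerate the outgoing and the incoming edges of each vertex in any order,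
  and the two kinds of lists need not be ordered consistently.\<close>

definition incidence_oracle :: "nat pair_pre_digraph \<Rightarrow> (query \<Rightarrow> answer) \<Rightarrow> bool" where
  "incidence_oracle G orc \<longleftrightarrow>
     (\<exists>outs ins.
        (\<forall>v. distinct (outs v) \<and> set (outs v) = out_arcs (with_proj G) v \<and>
             distinct (ins v) \<and> set (ins v) = in_arcs (with_proj G) v) \<and>
        (\<forall>v i. orc (Out_Edge v i) = entry (outs v) i \<and> orc (In_Edge v i) = entry (ins v) i))"

section \<open>Randomized adaptive query algorithms\<close>

text \<open>\<open>Answer True\<close> accepts and \<open>Answer False\<close> rejects. \<open>Random p f\<close> draws a number r from the
  distribution p and continues with \<open>f r\<close>. Only queries are charged.\<close>

datatype algorithm =
    Answer bool
  | Query query "answer \<Rightarrow> algorithm"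
  | Random "nat pmf" "nat \<Rightarrow> algorithm"

text \<open>Joint distribution of the verdict and the number of queries made.\<close>

primrec run :: "(query \<Rightarrow> answer) \<Rightarrow> algorithm \<Rightarrow> (bool \<times> nat) pmf" where
  "run orc (Answer b) = return_pmf (b, 0)"
| "run orc (Query q f) = map_pmf (\<lambda>(b, c). (b, Suc c)) (run orc (f (orc q)))"
| "run orc (Random p f) = bind_pmf p (\<lambda>r. run orc (f r))"

definition accept_prob :: "(query \<Rightarrow> answer) \<Rightarrow> algorithm \<Rightarrow> real" where
  "accept_prob orc A = measure_pmf.prob (run orc A) {r. fst r}"

definition reject_prob :: "(query \<Rightarrow> answer) \<Rightarrow> algorithm \<Rightarrow> real" where
  "reject_prob orc A = measure_pmf.prob (run orc A) {r. \<not> fst r}"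

text \<open>In the following, I is the class of admissible input graphs, P the property and F the
  predicate of being far from P.\<close>

definition property_tester ::
  "(nat pair_pre_digraph \<Rightarrow> bool) \<Rightarrow> (nat pair_pre_digraph \<Rightarrow> bool) \<Rightarrow>
   (nat pair_pre_digraph \<Rightarrow> bool) \<Rightarrow> algorithm \<Rightarrow> bool" where
  "property_tester I P F A \<longleftrightarrow>
     (\<forall>G orc. I G \<and> incidence_oracle G orc \<longrightarrow>
        (P G \<longrightarrow> accept_prob orc A \<ge> 2/3) \<and> (F G \<longrightarrow> reject_prob orc A \<ge> 2/3))"

definition one_sided ::
  "(nat pair_pre_digraph \<Rightarrow> bool) \<Rightarrow> (nat pair_pre_digraph \<Rightarrow> bool) \<Rightarrow> algorithm \<Rightarrow> bool" where
  "one_sided I P A \<longleftrightarrow>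
     (\<forall>G orc. I G \<and> incidence_oracle G orc \<and> P G \<longrightarrow> accept_prob orc A = 1)"

definition false_reject_at_most ::
  "(nat pair_pre_digraph \<Rightarrow> bool) \<Rightarrow> (nat pair_pre_digraph \<Rightarrow> bool) \<Rightarrow> real \<Rightarrow>
   algorithm \<Rightarrow> bool" where
  "false_reject_at_most I P p A \<longleftrightarrow>
     (\<forall>G orc. I G \<and> incidence_oracle G orc \<and> P G \<longrightarrow> reject_prob orc A \<le> p)"

text \<open>Worst case over all inputs and all random choices.\<close>

definition queries_at_most ::
  "(nat pair_pre_digraph \<Rightarrow> bool) \<Rightarrow> real \<Rightarrow> algorithm \<Rightarrow> bool" where
  "queries_at_most I B A \<longleftrightarrow>
     (\<forall>G orc. I G \<and> incidence_oracle G orc \<longrightarrow>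
        (\<forall>(b, c) \<in> set_pmf (run orc A). real c \<le> B))"

section \<open>The two input models\<close>

definition graph_with_edges :: "nat \<Rightarrow> nat \<Rightarrow> nat pair_pre_digraph \<Rightarrow> bool" where
  "graph_with_edges n m G \<longleftrightarrow> pair_digraph G \<and> pverts G = {..<n} \<and> card (parcs G) = m"

definition graph_with_degree_bound :: "nat \<Rightarrow> nat \<Rightarrow> nat pair_pre_digraph \<Rightarrow> bool" where
  "graph_with_degree_bound n d G \<longleftrightarrow> pair_digraph G \<and> pverts G = {..<n} \<and>
     (\<forall>v \<in> pverts G. out_degree (with_proj G) v \<le> d \<and> in_degree (with_proj G) v \<le> d)"

text \<open>The logarithm inside an O-bound. It is bounded below by 1: for arguments close to 1 the plain
  logarithm tends to 0 (and below 1 it is negative), so it cannot bound a query count there.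
  For arguments at least 2 this agrees with \<open>ln\<close> up to a constant factor.\<close>

definition olog :: "real \<Rightarrow> real" where
  "olog x = max 1 (ln x)"

end

theory Submission
  imports Defs
begin

text \<open>
  Write \<open>N(X)\<close> for the set of vertices outside X that are heads of arcs leaving X. Fix a set K of k
  vertices. If K is complete and every nonempty X disjoint from K has \<open>|N(X)| \<ge> k\<close>, for out- and for
  in-neighbourhoods, then the graph is k-vertex connected: a removed set of fewer than k vertices
  can neither cut a vertex off from K nor K off from it. Let z be a minimal vertex weighting with
  \<open>z(X) \<ge> k - |N(X)|\<close> for all such X. By submodularity of \<open>|N(X)|\<close> the maximal tight sets are disjoint,
  which bounds the total weight by k times the size of a disjoint family of sets with
  \<open>|N(X)| < k\<close>, and arcs into K can be added greedily, one per unit of weight. Hence a far graph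
  has many disjoint, mostly small, sets with fewer than k neighbours.

  A sampled vertex x in such a set L is turned into a certificate by a flow-like local search: k
  times, explore \<open>4 k |L|\<close> vertices that are on the source side of the minimal cut between x and the
  sinks chosen so far, and make a random one of them a new sink. Every new sink raises the minimal
  cut by one, while the cut N(L) remains smaller than k unless a sink falls into L, which has
  probability at most 1/4 in total. So some round runs out of vertices to explore, and then it has
  found a cut of size less than k. Sampling proportionally fewer vertices for larger size bounds
  balances the cost over all dyadic sizes; if n is too small for this, the whole graph is read.
\<close>

section \<open>Vertex neighbourhoods and augmentation\<close>

definition nbrs :: "'a rel \<Rightarrow> 'a set \<Rightarrow> 'a set" where
  "nbrs E A = E `` A - A"

lemma nbrs_mono: "E \<subseteq> F \<Longrightarrow> nbrs E A \<subseteq> nbrs F A"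
  unfolding nbrs_def by blast

lemma finite_nbrs: "finite E \<Longrightarrow> finite (nbrs E A)"
  unfolding nbrs_def by (auto intro: finite_Image)

lemma card_nbrs_mono: "finite F \<Longrightarrow> E \<subseteq> F \<Longrightarrow> card (nbrs E A) \<le> card (nbrs F A)"
  by (intro card_mono finite_nbrs nbrs_mono)

text \<open>The union of the two left-hand neighbourhoods lies in the union of the right-hand ones,
  and their intersection in the intersection; counting union plus intersection on each side gives
  the inequality.\<close>

lemma nbrs_submodular:
  assumes "finite E"
  shows "card (nbrs E (A \<union> B)) + card (nbrs E (A \<inter> B)) \<le> card (nbrs E A) + card (nbrs E B)"
proof -
  note fin = finite_nbrs[OF assms]
  have "card (nbrs E (A \<union> B)) + card (nbrs E (A \<inter> B))
      = card (nbrs E (A \<union> B) \<union> nbrs E (A \<inter> B)) + card (nbrs E (A \<union> B) \<inter> nbrs E (A \<inter> B))"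
    by (rule card_Un_Int[OF fin fin])
  also have "\<dots> \<le> card (nbrs E A \<union> nbrs E B) + card (nbrs E A \<inter> nbrs E B)"
    by (intro add_mono card_mono) (auto simp: fin, auto simp: nbrs_def)
  also have "\<dots> = card (nbrs E A) + card (nbrs E B)"
    by (rule card_Un_Int[OF fin fin, symmetric])
  finally show ?thesis .
qed

section \<open>Deficit covers, tight sets and greedy augmentation\<close>

text \<open>\<open>z v\<close> is a budget of arcs that may still be added at v; zero weights
  express the goal of the augmentation.\<close>

definition covers_deficits :: "'a rel \<Rightarrow> 'a set \<Rightarrow> nat \<Rightarrow> ('a \<Rightarrow> nat) \<Rightarrow> bool" where
  "covers_deficits E W k z \<longleftrightarrow> (\<forall>X \<subseteq> W. X \<noteq> {} \<longrightarrow> k \<le> card (nbrs E X) + sum z X)"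

definition tight_set :: "'a rel \<Rightarrow> 'a set \<Rightarrow> nat \<Rightarrow> ('a \<Rightarrow> nat) \<Rightarrow> 'a set \<Rightarrow> bool" where
  "tight_set E W k z X \<longleftrightarrow> X \<subseteq> W \<and> X \<noteq> {} \<and> card (nbrs E X) + sum z X = k"

lemma covers_deficitsD:
  "covers_deficits E W k z \<Longrightarrow> X \<subseteq> W \<Longrightarrow> X \<noteq> {} \<Longrightarrow> k \<le> card (nbrs E X) + sum z X"
  unfolding covers_deficits_def by blast

text \<open>Both the union and the nonempty intersection must reach k, while submodularity bounds
  their total by \<open>2 * k\<close>, so both are met with equality.\<close>

lemma tight_Un:
  assumes "finite E" "finite W" and cov: "covers_deficits E W k z"
    and X: "tight_set E W k z X" and Y: "tight_set E W k z Y" and "X \<inter> Y \<noteq> {}"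
  shows "tight_set E W k z (X \<union> Y)"
proof -
  have sub: "X \<subseteq> W" "Y \<subseteq> W" using X Y by (auto simp: tight_set_def)
  have fin: "finite X" "finite Y" using sub \<open>finite W\<close> finite_subset by blast+
  have "k \<le> card (nbrs E (X \<inter> Y)) + sum z (X \<inter> Y)"
    by (rule covers_deficitsD[OF cov]) (use assms(6) sub in auto)
  moreover have "k \<le> card (nbrs E (X \<union> Y)) + sum z (X \<union> Y)"
    by (rule covers_deficitsD[OF cov]) (use assms(6) sub in auto)
  moreover have "sum z (X \<union> Y) + sum z (X \<inter> Y) = sum z X + sum z Y"
    by (rule sum.union_inter[OF fin])
  moreover note nbrs_submodular[OF \<open>finite E\<close>, of X Y]
  ultimately show ?thesis using X Y unfolding tight_set_def by auto
qed

text \<open>Any two tight sets through v meet in v, so the finitely many of them can be merged one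
  by one into a largest one.\<close>

lemma tight_Union_at:
  assumes "finite E" "finite W" and cov: "covers_deficits E W k z"
    and "tight_set E W k z X" "v \<in> X"
  shows "tight_set E W k z (\<Union>{Y. tight_set E W k z Y \<and> v \<in> Y})"
proof -
  let ?F = "{Y. tight_set E W k z Y \<and> v \<in> Y}"
  have "finite ?F"
    by (rule finite_subset[of _ "Pow W"]) (use \<open>finite W\<close> in \<open>auto simp: tight_set_def\<close>)
  have "tight_set E W k z (\<Union>F) \<and> v \<in> \<Union>F" if "finite F" "F \<noteq> {}" "F \<subseteq> ?F" for F
    using that
  proof (induction rule: finite_ne_induct)
    case (insert Y F)
    have "Y \<inter> \<Union>F \<noteq> {}" using insert by blast
    then have "tight_set E W k z (Y \<union> \<Union>F)"
      using insert by (intro tight_Un[OF assms(1-3)]) auto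
    then show ?case using insert by auto
  qed auto
  from this[OF \<open>finite ?F\<close>] show ?thesis using assms(4,5) by blast
qed

lemma sum_update_pred:
  assumes "finite X" "v \<in> X" "(z :: 'a \<Rightarrow> nat) v > 0"
  shows "Suc (sum (z(v := z v - 1)) X) = sum z X"
proof -
  have "sum (z(v := z v - 1)) (X - {v}) = sum z (X - {v})" by (intro sum.cong) auto
  then show ?thesis using assms by (simp add: sum.remove[of X v])
qed

text \<open>Lowering \<open>z v\<close> breaks the condition for some X. This X must contain v, and
  losing one unit breaks it only if it had no slack.\<close>

lemma exists_tight_at:
  assumes "finite W" and cov: "covers_deficits E W k z" and "v \<in> W" "z v > 0"
    and not: "\<not> covers_deficits E W k (z(v := z v - 1))"
  shows "\<exists>X. tight_set E W k z X \<and> v \<in> X"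
proof -
  from not obtain X where X: "X \<subseteq> W" "X \<noteq> {}"
    "card (nbrs E X) + sum (z(v := z v - 1)) X < k"
    unfolding covers_deficits_def by (auto simp: not_le)
  have "finite X" using X(1) \<open>finite W\<close> finite_subset by blast
  have ge: "k \<le> card (nbrs E X) + sum z X" using covers_deficitsD[OF cov X(1,2)] .
  have "v \<in> X"
  proof (rule ccontr)
    assume "v \<notin> X"
    then have "sum (z(v := z v - 1)) X = sum z X" by (intro sum.cong) auto
    then show False using ge X(3) by simp
  qed
  then have "Suc (sum (z(v := z v - 1)) X) = sum z X"
    using \<open>finite X\<close> \<open>z v > 0\<close> by (intro sum_update_pred)
  then show ?thesis using X ge \<open>v \<in> X\<close> unfolding tight_set_def by (intro exI[of _ X]) auto
qed

text \<open>Induction on the total weight: one unit at some v is removed, either for free or in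
  exchange for one new arc from v to K. The bound \<open>k \<le> card K\<close> guarantees a new
  head for that arc.\<close>

lemma augment_to_root_set:
  assumes "finite W" "finite K" "W \<inter> K = {}" "card K \<ge> k" "finite E"
    and "covers_deficits E W k z"
  shows "\<exists>F \<subseteq> W \<times> K. card F \<le> sum z W \<and> covers_deficits (E \<union> F) W k (\<lambda>_. 0)"
  using assms(5,6)
proof (induction "sum z W" arbitrary: E z)
  case 0
  then have "\<forall>v\<in>W. z v = 0" using \<open>finite W\<close> by simp
  then have "covers_deficits E W k (\<lambda>_. 0)"
    using 0(3) unfolding covers_deficits_def by (metis subsetD sum.neutral)
  then show ?case by (intro exI[of _ "{}"]) auto
next
  case (Suc s)
  from Suc(2) obtain v where v: "v \<in> W" "z v > 0"
    by (metis gr0I nat.distinct(1) sum.neutral)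
  define z' where "z' = z(v := z v - 1)"
  have s: "s = sum z' W"
    using sum_update_pred[of W v z] Suc(2) v \<open>finite W\<close> by (simp add: z'_def)
  show ?case
  proof (cases "covers_deficits E W k z'")
    case True
    from Suc(1)[OF s Suc(3) True] obtain F where "F \<subseteq> W \<times> K" "card F \<le> sum z' W"
      "covers_deficits (E \<union> F) W k (\<lambda>_. 0)" by blast
    moreover have "sum z' W \<le> sum z W" using Suc(2) s by linarith
    ultimately show ?thesis by (meson order_trans)
  next
    case False
    define Y where "Y = \<Union>{Y. tight_set E W k z Y \<and> v \<in> Y}"
    obtain X where X: "tight_set E W k z X" "v \<in> X"
      using exists_tight_at[OF \<open>finite W\<close> Suc(4) v] False by (auto simp: z'_def)
    have Y: "tight_set E W k z Y"
      unfolding Y_def by (rule tight_Union_at[OF Suc(3) \<open>finite W\<close> Suc(4) X])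
    have "v \<in> Y" using X by (auto simp: Y_def)
    have "finite Y" using Y \<open>finite W\<close> finite_subset by (auto simp: tight_set_def)
    then have "z v \<le> sum z Y" using \<open>v \<in> Y\<close> by (simp add: member_le_sum)
    then have "card (nbrs E Y) < card K" using Y v(2) \<open>k \<le> card K\<close> by (simp add: tight_set_def)
    \<comment> \<open>Each tight set at v lies in Y, and \<open>nbrs E X \<inter> K\<close> grows with X because X avoids K. So the
      new arc (v, c) is useful for all tight sets at v at once, and z v may decrease.\<close>
    then obtain c where c: "c \<in> K" "c \<notin> nbrs E Y"
      by (meson Suc.prems(1) card_mono finite_nbrs leD subsetI)
    then have "c \<notin> E `` Y" using Y \<open>W \<inter> K = {}\<close> by (auto simp: nbrs_def tight_set_def)
    define E' where "E' = insert (v, c) E"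
    have "covers_deficits E' W k z'"
      unfolding covers_deficits_def
    proof (intro allI impI)
      fix A assume A: "A \<subseteq> W" "A \<noteq> {}"
      have "finite A" using A \<open>finite W\<close> finite_subset by blast
      have "finite E'" using Suc(3) by (simp add: E'_def)
      have ge: "k \<le> card (nbrs E A) + sum z A" by (rule covers_deficitsD[OF Suc(4) A])
      have mono: "card (nbrs E A) \<le> card (nbrs E' A)"
        by (rule card_nbrs_mono) (use Suc(3) in \<open>auto simp: E'_def\<close>)
      consider "v \<notin> A" | "v \<in> A" "tight_set E W k z A" | "v \<in> A" "\<not> tight_set E W k z A" by blast
      then show "k \<le> card (nbrs E' A) + sum z' A"
      proof cases
        case 1
        then have "sum z' A = sum z A" unfolding z'_def by (intro sum.cong) auto
        then show ?thesis using ge mono by simp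
      next
        case 2
        then have "A \<subseteq> Y" by (auto simp: Y_def)
        then have "c \<notin> nbrs E A" using \<open>c \<notin> E `` Y\<close> by (auto simp: nbrs_def)
        have "c \<notin> A" using c A \<open>W \<inter> K = {}\<close> by auto
        then have "insert c (nbrs E A) \<subseteq> nbrs E' A" using 2 by (auto simp: nbrs_def E'_def)
        then have "Suc (card (nbrs E A)) \<le> card (nbrs E' A)"
          using \<open>c \<notin> nbrs E A\<close> finite_nbrs[OF Suc(3)] finite_nbrs[OF \<open>finite E'\<close>]
          by (metis card_insert_disjoint card_mono)
        then show ?thesis
          using sum_update_pred[of A v z] 2 v \<open>finite A\<close> ge by (simp add: z'_def)
      next
        case 3
        then show ?thesis
          using sum_update_pred[of A v z] v \<open>finite A\<close> ge mono A by (simp add: z'_def tight_set_def)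
      qed
    qed
    from Suc(1)[OF s _ this] Suc(3) obtain F where F: "F \<subseteq> W \<times> K" "card F \<le> sum z' W"
      "covers_deficits (E' \<union> F) W k (\<lambda>_. 0)" by (auto simp: E'_def)
    have "finite F" using F(1) assms finite_subset by blast
    then have "card (insert (v, c) F) \<le> sum z W"
      using F(2) Suc(2) s card_insert_le_m1[of "sum z W" F "(v, c)"] by simp
    then show ?thesis
      using F v c by (intro exI[of _ "insert (v, c) F"]) (auto simp: E'_def)
  qed
qed

text \<open>In a cover of least total weight, every vertex of positive weight lies in a tight set.
  The maximal ones form the family: they carry all the weight, at most k each, and the positive
  weight leaves room for fewer than k neighbours.\<close>

lemma exists_cover_with_disjoint_family:
  fixes W :: "'a set"
  assumes "finite W" "finite E"
  shows "\<exists>z \<X>. covers_deficits E W k z \<and> disjoint \<X> \<and> \<X> \<subseteq> Pow W - {{}} \<and>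
           (\<forall>X\<in>\<X>. card (nbrs E X) < k) \<and> sum z W \<le> k * card \<X>"
proof -
  \<comment> \<open>The constant weight k is a cover, so a least one exists.\<close>
  have "covers_deficits E W k (\<lambda>_. k)"
    unfolding covers_deficits_def
  proof (intro allI impI)
    fix X assume "X \<subseteq> W" "X \<noteq> {}"
    then have "card X > 0" using \<open>finite W\<close> finite_subset by (auto simp: card_gt_0_iff)
    then show "k \<le> card (nbrs E X) + (\<Sum>_\<in>X. k)" by (simp add: trans_le_add2)
  qed
  then obtain z where cov: "covers_deficits E W k z"
    and min: "\<And>z'. covers_deficits E W k z' \<Longrightarrow> sum z W \<le> sum z' W"
    using ex_has_least_nat[of "covers_deficits E W k" _ "\<lambda>z. sum z W"] by blast
  define Y where "Y v = \<Union>{X. tight_set E W k z X \<and> v \<in> X}" for v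
  define S where "S = {v \<in> W. z v > 0}"
  have tight_Y: "tight_set E W k z (Y v) \<and> v \<in> Y v" if "v \<in> S" for v
  proof -
    have v: "v \<in> W" "z v > 0" using that by (auto simp: S_def)
    have "\<not> covers_deficits E W k (z(v := z v - 1))"
      using min sum_update_pred[of W v z] v \<open>finite W\<close> by (metis Suc_n_not_le_n)
    from exists_tight_at[OF \<open>finite W\<close> cov v this]
    obtain X where "tight_set E W k z X" "v \<in> X" by blast
    then show ?thesis
      using tight_Union_at[OF assms(2,1) cov, of X v] unfolding Y_def by blast
  qed
  \<comment> \<open>The union of two meeting maximal tight sets is tight and contains both v and w,
    so it lies in each of them.\<close>
  have eq: "Y v = Y w" if "v \<in> S" "w \<in> S" "Y v \<inter> Y w \<noteq> {}" for v w
  proof -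
    have "tight_set E W k z (Y v \<union> Y w)"
      using tight_Un[OF assms(2,1) cov] tight_Y that by blast
    then have "Y v \<union> Y w \<subseteq> Y v" "Y v \<union> Y w \<subseteq> Y w"
      using tight_Y[OF that(1)] tight_Y[OF that(2)] by (auto simp: Y_def[of v], auto simp: Y_def[of w])
    then show ?thesis by blast
  qed
  have sub: "Y v \<subseteq> W" "finite (Y v)" if "v \<in> S" for v
    using tight_Y[OF that] \<open>finite W\<close> finite_subset by (auto simp: tight_set_def)
  have "finite S" using \<open>finite W\<close> by (simp add: S_def)
  have disj: "A \<inter> B = {}" if "A \<in> Y ` S" "B \<in> Y ` S" "A \<noteq> B" for A B
    using eq that by blast
  have "sum z W = sum z (\<Union>(Y ` S))"
    by (rule sum.mono_neutral_right[OF \<open>finite W\<close>]) (use sub tight_Y in \<open>auto simp: S_def\<close>)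
  also have "\<dots> \<le> sum (sum z) (Y ` S)"
    using sub \<open>finite S\<close> disj by (subst sum.Union_disjoint) auto
  also have "\<dots> \<le> (\<Sum>X\<in>Y ` S. k)"
    by (rule sum_mono) (use tight_Y in \<open>fastforce simp: tight_set_def\<close>)
  finally have "sum z W \<le> k * card (Y ` S)" by (simp add: mult.commute)
  moreover have "card (nbrs E (Y v)) < k" if "v \<in> S" for v
  proof -
    have "z v \<le> sum z (Y v)" using tight_Y[OF that] sub[OF that] by (simp add: member_le_sum)
    then show ?thesis using tight_Y[OF that] that by (auto simp: tight_set_def S_def)
  qed
  moreover have "disjoint (Y ` S)" using disj by (auto simp: disjoint_def)
  moreover have "Y ` S \<subseteq> Pow W - {{}}" using sub tight_Y by blast
  ultimately show ?thesis using cov by blast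
qed

section \<open>From neighbourhood sizes to vertex connectivity and to distance\<close>

text \<open>Otherwise the set reached from u avoids K and so has at least k neighbours; yet all of
  these lie in S, because any other neighbour would be reached too.\<close>

lemma reaches_root_set:
  assumes "finite V" "E \<subseteq> V \<times> V" "S \<subseteq> V" "card S < k" "u \<in> V - S"
    and cov: "covers_deficits E (V - K) k (\<lambda>_. 0)"
  shows "\<exists>c \<in> K - S. (u, c) \<in> rtrancl_on (V - S) {e \<in> E. fst e \<in> V - S \<and> snd e \<in> V - S}"
proof (rule ccontr)
  assume contr: "\<not> ?thesis"
  define r where "r = {e \<in> E. fst e \<in> V - S \<and> snd e \<in> V - S}"
  define A where "A = {w. (u, w) \<in> rtrancl_on (V - S) r}"
  have A: "A \<subseteq> V - S" "u \<in> A"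
    using assms(5) by (auto simp: A_def dest: in_rtrancl_on_in_F)
  have "A \<inter> K = {}" using contr A by (auto simp: A_def r_def)
  then have "k \<le> card (nbrs E A)"
    using covers_deficitsD[OF cov, of A] A by auto
  also have "nbrs E A \<subseteq> S"
  proof
    fix y assume "y \<in> nbrs E A"
    then obtain x where x: "x \<in> A" "(x, y) \<in> E" "y \<notin> A" by (auto simp: nbrs_def)
    show "y \<in> S"
    proof (rule ccontr)
      assume "y \<notin> S"
      then have "(x, y) \<in> r" "y \<in> V - S" using x A assms(2) by (auto simp: r_def)
      then have "y \<in> A" using x(1) by (auto simp: A_def intro: rtrancl_on_into_rtrancl_on)
      with x(3) show False by simp
    qed
  qed
  then have "card (nbrs E A) \<le> card S" using assms(1,3) by (meson card_mono finite_subset)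
  finally show False using assms(4) by simp
qed

lemma arcs_ends_induce_subgraph:
  "arcs_ends (induce_subgraph (with_proj G) W) = {e \<in> parcs G. fst e \<in> W \<and> snd e \<in> W}"
  by (auto simp: induce_subgraph_def arcs_ends_def arc_to_ends_def)

lemma strongly_connected_induce_subgraph_iff:
  "strongly_connected (induce_subgraph (with_proj G) W) \<longleftrightarrow>
     W \<noteq> {} \<and> (\<forall>u\<in>W. \<forall>v\<in>W. (u, v) \<in> rtrancl_on W {e \<in> parcs G. fst e \<in> W \<and> snd e \<in> W})"
  unfolding strongly_connected_def reachable_def arcs_ends_induce_subgraph by simp

text \<open>After S is removed, u reaches some c in K, and v is reached from some d in K by the same
  argument on reversed arcs. Unless they coincide, an arc of the complete set K joins c to
  d.\<close>

lemma k_vertex_connected_if_rooted: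
  fixes G :: "'a pair_pre_digraph"
  defines "V \<equiv> pverts G" and "E \<equiv> parcs G"
  assumes "finite V" "E \<subseteq> V \<times> V" "K \<subseteq> V" "k < card V" "K \<times> K - Id \<subseteq> E"
    and out: "covers_deficits E (V - K) k (\<lambda>_. 0)"
    and inn: "covers_deficits (E\<inverse>) (V - K) k (\<lambda>_. 0)"
  shows "k_vertex_connected k G"
  unfolding k_vertex_connected_def strongly_connected_induce_subgraph_iff
    V_def[symmetric] E_def[symmetric]
proof (intro conjI allI impI ballI)
  show "k < card V" by fact
next
  fix S assume S: "S \<subseteq> V" "card S < k"
  then show "V - S \<noteq> {}" using \<open>k < card V\<close> by (metis Diff_eq_empty_iff antisym less_asym)
next
  fix S u v assume S: "S \<subseteq> V" "card S < k" and u: "u \<in> V - S" and v: "v \<in> V - S"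
  define r where "r = {e \<in> E. fst e \<in> V - S \<and> snd e \<in> V - S}"
  have r: "{e \<in> E\<inverse>. fst e \<in> V - S \<and> snd e \<in> V - S} = r\<inverse>" by (auto simp: r_def)
  obtain c where c: "c \<in> K - S" "(u, c) \<in> rtrancl_on (V - S) r"
    using reaches_root_set[OF assms(3,4) S u out] unfolding r_def by blast
  have conv: "E\<inverse> \<subseteq> V \<times> V" using assms(4) by blast
  obtain d where d: "d \<in> K - S" "(v, d) \<in> rtrancl_on (V - S) (r\<inverse>)"
    using reaches_root_set[OF assms(3) conv S v inn] unfolding r by blast
  have "(c, d) \<in> rtrancl_on (V - S) r"
  proof (cases "c = d")
    case False
    then have "(c, d) \<in> r" using c d assms(5,7) by (auto simp: r_def)
    then show ?thesis
      using c d assms(5) by (auto intro!: rtrancl_on_into_rtrancl_on[of c c])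
  qed (use d assms(5) in auto)
  moreover have "(d, v) \<in> rtrancl_on (V - S) r"
    using rtrancl_on_converseI[OF d(2)] by simp
  ultimately show "(u, v) \<in> rtrancl_on (V - S) r" using c(2) by (meson rtrancl_on_trans)
qed

lemma rtrancl_on_stays:
  assumes "(u, v) \<in> rtrancl_on F r" "u \<in> A" "r `` A \<subseteq> A"
  shows "v \<in> A"
  using assms by induction auto

text \<open>Soundness of certificates: removing \<open>nbrs F A\<close> leaves no arc out of A (into
  A for reversed arcs), and the second size bound leaves a vertex outside to be separated from
  A.\<close>

lemma not_k_vertex_connected_if_small_nbrs:
  fixes G :: "'a pair_pre_digraph"
  defines "V \<equiv> pverts G" and "E \<equiv> parcs G"
  assumes "finite V" "E \<subseteq> V \<times> V" "A \<subseteq> V" "A \<noteq> {}"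
    and F: "F = E \<or> F = E\<inverse>"
    and small: "card (nbrs F A) < k" "card A + card (nbrs F A) < card V"
  shows "\<not> k_vertex_connected k G"
proof
  assume "k_vertex_connected k G"
  define S where "S = nbrs F A"
  define r where "r = {e \<in> E. fst e \<in> V - S \<and> snd e \<in> V - S}"
  have "S \<subseteq> V" using F assms(4) by (auto simp: S_def nbrs_def)
  then have sc: "\<And>u v. u \<in> V - S \<Longrightarrow> v \<in> V - S \<Longrightarrow> (u, v) \<in> rtrancl_on (V - S) r"
    using \<open>k_vertex_connected k G\<close> small(1)
    unfolding k_vertex_connected_def strongly_connected_induce_subgraph_iff r_def
      V_def[symmetric] E_def[symmetric] S_def by blast
  obtain u where u: "u \<in> A" using assms(6) by blast
  have "card (A \<union> S) < card V"
    using small(2) card_Un_le[of A S] by (simp add: S_def)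
  then obtain v where v: "v \<in> V" "v \<notin> A \<union> S"
    using \<open>A \<subseteq> V\<close> \<open>S \<subseteq> V\<close> by (metis Un_subset_iff less_irrefl subsetI subset_antisym)
  have "A \<inter> S = {}" by (auto simp: S_def nbrs_def)
  then have uv: "u \<in> V - S" "v \<in> V - S" using u v \<open>A \<subseteq> V\<close> by auto
  from F show False
  proof
    assume "F = E"
    then have "r `` A \<subseteq> A" by (auto simp: r_def S_def nbrs_def)
    from rtrancl_on_stays[OF sc[OF uv] u this] v show False by simp
  next
    assume "F = E\<inverse>"
    then have "(r\<inverse>) `` A \<subseteq> A" by (auto simp: r_def S_def nbrs_def)
    from rtrancl_on_stays[OF rtrancl_on_converseI[OF sc[OF uv(2,1)]] u this] v show False by simp
  qed
qed

text \<open>Completing K and adding the arcs of both augmentations makes G k-vertex connected, at a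
  cost of at most \<open>k * k\<close> plus k per member of the two families. For a far graph this
  cost exceeds t.\<close>

lemma disjoint_families_if_far:
  fixes G :: "'a pair_pre_digraph"
  defines "V \<equiv> pverts G" and "E \<equiv> parcs G"
  assumes "pair_digraph G" and "k < card V"
    and far: "needs_more_modifications (k_vertex_connected k) t G"
  shows "\<exists>\<X> \<Y>. disjoint \<X> \<and> \<X> \<subseteq> Pow V - {{}} \<and> (\<forall>X\<in>\<X>. card (nbrs E X) < k) \<and>
           disjoint \<Y> \<and> \<Y> \<subseteq> Pow V - {{}} \<and> (\<forall>Y\<in>\<Y>. card (nbrs (E\<inverse>) Y) < k) \<and>
           t < real (k * k + k * card \<X> + k * card \<Y>)"
proof -
  interpret pair_digraph G by fact
  have V: "finite V" "E \<subseteq> V \<times> V" "\<And>v. (v, v) \<notin> E"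
    using pair_finite_verts in_arcsD1 in_arcsD2 pair_no_loops by (auto simp: V_def E_def) fastforce
  have "finite E" using V finite_subset by blast
  obtain K where K: "K \<subseteq> V" "card K = k"
    using \<open>k < card V\<close> by (meson less_imp_le obtain_subset_with_card_n)
  define W where "W = V - K"
  have W: "finite W" "finite K" "W \<inter> K = {}" "k \<le> card K"
    using V K finite_subset by (auto simp: W_def)
  obtain z \<X> where z: "covers_deficits E W k z" "sum z W \<le> k * card \<X>"
    and \<X>: "disjoint \<X>" "\<X> \<subseteq> Pow W - {{}}" "\<forall>X\<in>\<X>. card (nbrs E X) < k"
    using exists_cover_with_disjoint_family[OF W(1) \<open>finite E\<close>, of k] by blast
  have "finite (E\<inverse>)" using \<open>finite E\<close> by simp
  obtain y \<Y> where y: "covers_deficits (E\<inverse>) W k y" "sum y W \<le> k * card \<Y>"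
    and \<Y>: "disjoint \<Y>" "\<Y> \<subseteq> Pow W - {{}}" "\<forall>Y\<in>\<Y>. card (nbrs (E\<inverse>) Y) < k"
    using exists_cover_with_disjoint_family[OF W(1) \<open>finite (E\<inverse>)\<close>, of k] by blast
  obtain P where P: "P \<subseteq> W \<times> K" "card P \<le> sum z W" "covers_deficits (E \<union> P) W k (\<lambda>_. 0)"
    using augment_to_root_set[OF W \<open>finite E\<close> z(1)] by blast
  obtain Q where Q: "Q \<subseteq> W \<times> K" "card Q \<le> sum y W" "covers_deficits (E\<inverse> \<union> Q) W k (\<lambda>_. 0)"
    using augment_to_root_set[OF W \<open>finite (E\<inverse>)\<close> y(1)] by blast
  define N where "N = (K \<times> K - Id) \<union> P \<union> Q\<inverse>"
  define H where "H = \<lparr>pverts = V, parcs = E \<union> N\<rparr>"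
  have fin: "finite P" "finite Q" using P(1) Q(1) W(1,2) finite_subset by blast+
  have N: "N \<subseteq> V \<times> V" "\<And>v. (v, v) \<notin> N"
    using P(1) Q(1) K(1) by (auto simp: N_def W_def)
  have "finite N" using fin W(2) by (simp add: N_def)
  have "pair_digraph H"
    by unfold_locales (use V N \<open>finite E\<close> \<open>finite N\<close> in \<open>auto simp: H_def\<close>)
  \<comment> \<open>Arcs added for the other direction and for K can only enlarge neighbourhoods, so
    each augmentation survives the combination.\<close>
  have up: "covers_deficits F' W k (\<lambda>_. 0)"
    if "covers_deficits F W k (\<lambda>_. 0)" "F \<subseteq> F'" "finite F'" for F F'
    using that card_nbrs_mono[OF that(3,2)] unfolding covers_deficits_def
    by (metis (no_types, lifting) le_trans add_le_mono1)
  have "k_vertex_connected k H"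
  proof (rule k_vertex_connected_if_rooted[of H K k], goal_cases)
    case 6
    show ?case using up[OF P(3), of "E \<union> N"] \<open>finite E\<close> \<open>finite N\<close> by (auto simp: H_def N_def W_def)
  next
    case 7
    show ?case using up[OF Q(3), of "(E \<union> N)\<inverse>"] \<open>finite E\<close> \<open>finite N\<close>
      by (auto simp: H_def N_def W_def converse_Un)
  qed (use V N K \<open>k < card V\<close> in \<open>auto simp: H_def N_def\<close>)
  then have "t < real (modifications G H)"
    using far \<open>pair_digraph H\<close> unfolding needs_more_modifications_def by (auto simp: H_def V_def)
  also have "modifications G H \<le> card N"
    unfolding modifications_def by (rule card_mono[OF \<open>finite N\<close>]) (auto simp: H_def E_def)
  also have "card N \<le> card (K \<times> K - Id) + card P + card (Q\<inverse>)"
    unfolding N_def by (meson add_le_mono1 card_Un_le le_trans)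
  also have "\<dots> \<le> k * k + k * card \<X> + k * card \<Y>"
  proof (intro add_mono)
    show "card (K \<times> K - Id) \<le> k * k"
      using card_mono[of "K \<times> K" "K \<times> K - Id"] W(2) K(2) by (simp add: card_cartesian_product)
    show "card P \<le> k * card \<X>" using P(2) z(2) by simp
    show "card (Q\<inverse>) \<le> k * card \<Y>" using Q(2) y(2) by (simp add: card_inverse)
  qed
  finally have "t < real (k * k + k * card \<X> + k * card \<Y>)" by simp
  moreover have "\<X> \<subseteq> Pow V - {{}}" "\<Y> \<subseteq> Pow V - {{}}" using \<X>(2) \<Y>(2) by (auto simp: W_def)
  ultimately show ?thesis using \<X>(1,3) \<Y>(1,3) by blast
qed

section \<open>Local search for small cuts\<close>

lemma accept_prob_eq_pmf: "accept_prob orc A = pmf (map_pmf fst (run orc A)) True"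
  by (simp add: accept_prob_def pmf_map vimage_def)

lemma accept_prob_Answer [simp]: "accept_prob orc (Answer b) = of_bool b"
  by (simp add: accept_prob_eq_pmf)

lemma accept_prob_Query [simp]: "accept_prob orc (Query q f) = accept_prob orc (f (orc q))"
  by (simp add: accept_prob_eq_pmf map_pmf_comp case_prod_unfold)

lemma accept_prob_Random [simp]:
  "accept_prob orc (Random p f) = measure_pmf.expectation p (\<lambda>r. accept_prob orc (f r))"
  by (simp add: accept_prob_eq_pmf map_bind_pmf pmf_bind)

lemma accept_prob_nonneg: "0 \<le> accept_prob orc A"
  and accept_prob_le_1: "accept_prob orc A \<le> 1"
  by (simp_all add: accept_prob_def)

lemma reject_prob_eq: "reject_prob orc A = 1 - accept_prob orc A"
proof -
  have "{r. \<not> fst r} = space (measure_pmf (run orc A)) - {r. fst r}" by auto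
  then show ?thesis
    unfolding reject_prob_def accept_prob_def by (simp only: measure_pmf.prob_compl sets_measure_pmf UNIV_I)
qed

definition max_queries :: "(query \<Rightarrow> answer) \<Rightarrow> algorithm \<Rightarrow> nat \<Rightarrow> bool" where
  "max_queries orc A B \<longleftrightarrow> (\<forall>(b, c) \<in> set_pmf (run orc A). c \<le> B)"

lemma max_queries_Answer [simp]: "max_queries orc (Answer b) B"
  by (simp add: max_queries_def)

lemma max_queries_Query: "max_queries orc (f (orc q)) B \<Longrightarrow> max_queries orc (Query q f) (Suc B)"
  by (auto simp: max_queries_def)

lemma max_queries_Random: "(\<And>r. max_queries orc (f r) B) \<Longrightarrow> max_queries orc (Random p f) B"
  by (auto simp: max_queries_def)

lemma max_queries_mono: "max_queries orc A B \<Longrightarrow> B \<le> B' \<Longrightarrow> max_queries orc A B'"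
  by (force simp: max_queries_def)

primrec and_then :: "algorithm \<Rightarrow> algorithm \<Rightarrow> algorithm" where
  "and_then (Answer b) B = (if b then B else Answer False)"
| "and_then (Query q f) B = Query q (\<lambda>a. and_then (f a) B)"
| "and_then (Random p f) B = Random p (\<lambda>r. and_then (f r) B)"

text \<open>The second algorithm draws fresh random numbers and faces the same fixed oracle, so the
  two acceptances are independent.\<close>

lemma accept_prob_and_then:
  "accept_prob orc (and_then A B) = accept_prob orc A * accept_prob orc B"
  by (induction A) auto

lemma max_queries_and_then:
  assumes "max_queries orc A a" "max_queries orc B b"
  shows "max_queries orc (and_then A B) (a + b)"
  using assms(1)
proof (induction A arbitrary: a)
  case (Answer c)
  then show ?case using max_queries_mono[OF assms(2)] by simp
next
  case (Query q f)
  have "\<forall>(c, d) \<in> set_pmf (run orc (f (orc q))). Suc d \<le> a"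
    using Query.prems by (auto simp: max_queries_def)
  \<comment> \<open>Some run of the continuation exists, so a is at least 1 and one unit can be set
    aside for this query.\<close>
  moreover obtain c d where "(c, d) \<in> set_pmf (run orc (f (orc q)))"
    using set_pmf_not_empty by (metis ex_in_conv surj_pair)
  ultimately obtain a' where a': "a = Suc a'" by (cases a) auto
  then have "max_queries orc (f (orc q)) a'" using Query.prems by (auto simp: max_queries_def)
  from Query.IH[OF _ this] show ?case unfolding a' and_then.simps add_Suc
    by (intro max_queries_Query) auto
next
  case (Random p f)
  then show ?case by (auto simp: max_queries_def split_beta)
qed

definition run_all :: "algorithm list \<Rightarrow> algorithm" where
  "run_all As = foldr and_then As (Answer True)"

lemma accept_prob_run_all:
  "accept_prob orc (run_all As) = prod_list (map (accept_prob orc) As)"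
  by (induction As) (auto simp: run_all_def accept_prob_and_then)

lemma max_queries_run_all:
  "(\<And>A. A \<in> set As \<Longrightarrow> max_queries orc A (b A)) \<Longrightarrow>
     max_queries orc (run_all As) (sum_list (map b As))"
  by (induction As) (auto simp: run_all_def intro!: max_queries_and_then)

section \<open>Reading one incidence list in either direction\<close>

text \<open>The flag \<open>out\<close> chooses between outgoing and incoming lists, so that one
  search serves both kinds of neighbourhoods.\<close>

definition edge_query :: "bool \<Rightarrow> nat \<Rightarrow> nat \<Rightarrow> query" where
  "edge_query out v i = (if out then Out_Edge v i else In_Edge v i)"

definition other_end :: "bool \<Rightarrow> nat \<times> nat \<Rightarrow> nat" where
  "other_end out e = (if out then snd e else fst e)"

definition orient :: "bool \<Rightarrow> 'a rel \<Rightarrow> 'a rel" where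
  "orient out E = (if out then E else E\<inverse>)"

text \<open>D is a query budget; \<open>None\<close> is passed on when it is used up before the end
  of the list is seen. As seeing the end takes one extra query, a search from position 0 fails
  exactly for degrees of at least D.\<close>

primrec fetch_nbrs ::
  "bool \<Rightarrow> nat \<Rightarrow> nat \<Rightarrow> nat \<Rightarrow> nat set \<Rightarrow> (nat set option \<Rightarrow> algorithm) \<Rightarrow> algorithm" where
  "fetch_nbrs out v 0 i S f = f None"
| "fetch_nbrs out v (Suc D) i S f = Query (edge_query out v i) (\<lambda>a. case a of
      None \<Rightarrow> f (Some S)
    | Some e \<Rightarrow> fetch_nbrs out v D (Suc i) (insert (other_end out e) S) f)"

lemma max_queries_fetch_nbrs:
  assumes "\<And>S. max_queries orc (f S) B"
  shows "max_queries orc (fetch_nbrs out v D i S f) (D + B)"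
proof (induction D arbitrary: i S)
  case (Suc D)
  show ?case unfolding fetch_nbrs.simps add_Suc
    by (rule max_queries_Query)
      (use Suc max_queries_mono[OF assms] in \<open>auto split: option.split\<close>)
qed (use assms in auto)

locale nbr_oracle =
  fixes orc :: "query \<Rightarrow> answer" and out :: bool and n :: nat and E0 :: "nat rel"
    and nbr_list :: "nat \<Rightarrow> nat list"
  assumes E0_sub: "E0 \<subseteq> {..<n} \<times> {..<n}"
    and distinct_nbr_list: "\<And>v. distinct (nbr_list v)"
    and set_nbr_list: "\<And>v. set (nbr_list v) = E0 `` {v}"
    and entry_nbr_list:
      "\<And>v i. map_option (other_end out) (orc (edge_query out v i)) = entry (nbr_list v) i"
begin

lemma finite_E0: "finite E0"
  using E0_sub by (rule finite_subset) simp

lemma length_nbr_list: "length (nbr_list v) = card (E0 `` {v})"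
  using distinct_card[OF distinct_nbr_list] set_nbr_list by metis

lemma accept_prob_fetch_nbrs_from:
  assumes "i \<le> length (nbr_list v)"
  shows "accept_prob orc (fetch_nbrs out v D i S f) =
    accept_prob orc (f (if length (nbr_list v) < i + D
      then Some (S \<union> set (drop i (nbr_list v))) else None))"
  using assms
proof (induction D arbitrary: i S)
  case (Suc D)
  show ?case
  proof (cases "i < length (nbr_list v)")
    case True
    then obtain e where e: "orc (edge_query out v i) = Some e" "other_end out e = nbr_list v ! i"
      using entry_nbr_list[of v i] by (auto simp: entry_def)
    have "set (drop i (nbr_list v)) = insert (nbr_list v ! i) (set (drop (Suc i) (nbr_list v)))"
      using True by (metis Cons_nth_drop_Suc list.simps(15))
    then show ?thesis using Suc.IH[of "Suc i"] True e by simp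
  next
    case False
    then have "orc (edge_query out v i) = None"
      using entry_nbr_list[of v i] by (auto simp: entry_def)
    then show ?thesis using False Suc.prems by simp
  qed
qed auto

lemma accept_prob_fetch_nbrs:
  "accept_prob orc (fetch_nbrs out v D 0 {} f) =
    accept_prob orc (f (if card (E0 `` {v}) < D then Some (E0 `` {v}) else None))"
  by (simp add: accept_prob_fetch_nbrs_from set_nbr_list flip: length_nbr_list)

end

section \<open>Minimal cuts relative to a list of sinks\<close>

definition cut_cost :: "'a rel \<Rightarrow> 'a list \<Rightarrow> 'a set \<Rightarrow> nat" where
  "cut_cost E T A = card (nbrs E A) + length (filter (\<lambda>u. u \<in> A) T)"

text \<open>With arcs E and sinks T, \<open>cut_cost E T A\<close> is the cost of separating a source in A from a
  super-sink attached to the members of T with multiplicity. In flow terms, \<open>near_side\<close> is the set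
  reachable from x in the residual graph when T is saturated; using minimal cuts instead avoids
  flows altogether.\<close>

definition near_side :: "nat \<Rightarrow> nat \<Rightarrow> nat rel \<Rightarrow> nat list \<Rightarrow> nat set" where
  "near_side n x E T = \<Inter>{A. x \<in> A \<and> A \<subseteq> {..<n} \<and> cut_cost E T A \<le> length T}"

text \<open>When E holds all arcs with tail in U, the inclusion of A in U means that every arc
  leaving A is known, so A is a certificate valid for the whole graph.\<close>

definition small_cut :: "nat \<Rightarrow> nat \<Rightarrow> nat set \<Rightarrow> nat rel \<Rightarrow> bool" where
  "small_cut n k U E \<longleftrightarrow>
     (\<exists>A \<subseteq> U \<inter> {..<n}. A \<noteq> {} \<and> card (nbrs E A) < k \<and> card A + card (nbrs E A) < n)"

lemma cut_cost_submodular: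
  assumes "finite E"
  shows "cut_cost E T (A \<union> B) + cut_cost E T (A \<inter> B) \<le> cut_cost E T A + cut_cost E T B"
proof -
  have "length (filter (\<lambda>u. u \<in> A \<union> B) T) + length (filter (\<lambda>u. u \<in> A \<inter> B) T)
      = length (filter (\<lambda>u. u \<in> A) T) + length (filter (\<lambda>u. u \<in> B) T)"
    by (induction T) auto
  then show ?thesis using nbrs_submodular[OF assms, of A B] by (simp add: cut_cost_def)
qed

lemma near_side_subset:
  assumes "x < n" "E \<subseteq> {..<n} \<times> {..<n}"
  shows "near_side n x E T \<subseteq> {..<n}"
proof -
  have "nbrs E {..<n} = {}" using assms(2) by (auto simp: nbrs_def)
  then have "cut_cost E T {..<n} \<le> length T" by (simp add: cut_cost_def)
  then show ?thesis using assms(1) by (auto simp: near_side_def)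
qed

text \<open>Sets attaining the minimum are closed under intersection: the union contains x and so
  costs at least \<open>length T\<close>, and submodularity then bounds the intersection. The full
  vertex set starts the family off.\<close>

lemma cut_cost_near_side:
  assumes "x < n" "E \<subseteq> {..<n} \<times> {..<n}"
    and min: "\<And>A. x \<in> A \<Longrightarrow> A \<subseteq> {..<n} \<Longrightarrow> length T \<le> cut_cost E T A"
  shows "cut_cost E T (near_side n x E T) \<le> length T"
proof -
  let ?F = "{A. x \<in> A \<and> A \<subseteq> {..<n} \<and> cut_cost E T A \<le> length T}"
  have "finite E" using assms(2) by (rule finite_subset) simp
  have "nbrs E {..<n} = {}" using assms(2) by (auto simp: nbrs_def)
  then have "{..<n} \<in> ?F" using assms(1) by (simp add: cut_cost_def)
  have "finite ?F" by (rule finite_subset[of _ "Pow {..<n}"]) auto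
  have "\<Inter>F \<in> ?F" if "finite F" "F \<noteq> {}" "F \<subseteq> ?F" for F
    using that
  proof (induction rule: finite_ne_induct)
    case (insert B F)
    then have *: "B \<in> ?F" "\<Inter>F \<in> ?F" by auto
    then have "length T \<le> cut_cost E T (B \<union> \<Inter>F)" by (intro min) auto
    then have "cut_cost E T (B \<inter> \<Inter>F) \<le> length T"
      using cut_cost_submodular[OF \<open>finite E\<close>, of T B "\<Inter>F"] * by simp
    then show ?case using * by auto
  qed auto
  from this[OF \<open>finite ?F\<close>] \<open>{..<n} \<in> ?F\<close> show ?thesis unfolding near_side_def by blast
qed

text \<open>More arcs raise the costs and so shrink the family being intersected. Hence exploration
  never removes vertices from the near side.\<close>

lemma near_side_mono:
  assumes "E \<subseteq> E'" "finite E'"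
  shows "near_side n x E T \<subseteq> near_side n x E' T"
proof -
  have "cut_cost E T A \<le> cut_cost E' T A" for A
    using card_nbrs_mono[OF assms(2,1)] by (simp add: cut_cost_def)
  then show ?thesis unfolding near_side_def using order_trans by blast
qed

text \<open>A cut A that attains the minimum contains the near side, hence u, and so pays for the new sink;
  any other cut was at least one unit more expensive already.\<close>

lemma cut_cost_add_sink:
  assumes "u \<in> near_side n x E T" "x \<in> A" "A \<subseteq> {..<n}" "length T \<le> cut_cost E T A"
  shows "length (u # T) \<le> cut_cost E (u # T) A"
proof (cases "cut_cost E T A \<le> length T")
  case True
  then have "u \<in> A" using assms unfolding near_side_def by blast
  then show ?thesis using assms(4) by (simp add: cut_cost_def)
qed (simp add: cut_cost_def)

text \<open>U is the set of vertices whose incidence lists are known and E the set of their arcs; i counts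
  the sinks still to be placed and c bounds the remaining explorations before the next sink. A sink
  is drawn at random from M explored vertices of the near side, or is a vertex of degree at least D,
  which is too large for it to lie in the cut that is searched for. As long as no sink falls into
  a set L around x with \<open>card (nbrs E L) < k\<close>, the minimal cost is the number of sinks, so k sinks
  cannot be placed.\<close>

function local_search :: "bool \<Rightarrow> nat \<Rightarrow> nat \<Rightarrow> nat \<Rightarrow> nat \<Rightarrow> nat \<Rightarrow>
    nat \<Rightarrow> nat \<Rightarrow> nat set \<Rightarrow> nat rel \<Rightarrow> nat list \<Rightarrow> algorithm" where
  "local_search out n k M D x 0 c U E T = Answer True"
| "local_search out n k M D x (Suc i) c U E T =
    (if small_cut n k U E then Answer False
     else if c = 0 \<or> M \<le> card (near_side n x E T \<inter> U)
     then Random (pmf_of_set (near_side n x E T \<inter> U))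
       (\<lambda>u. local_search out n k M D x i M U E (u # T))
     else let w = SOME w. w \<in> near_side n x E T \<and> w \<notin> U in
       fetch_nbrs out w D 0 {} (\<lambda>N. case N of
         None \<Rightarrow> local_search out n k M D x i M U E (w # T)
       | Some S \<Rightarrow> local_search out n k M D x (Suc i) (c - 1) (insert w U) (E \<union> {w} \<times> S) T))"
  by pat_completeness auto
termination
  by (relation "measures [\<lambda>(out, n, k, M, D, x, i, c, U, E, T). i,
      \<lambda>(out, n, k, M, D, x, i, c, U, E, T). c]") auto

section \<open>Cost and correctness of the local search\<close>

text \<open>An exploration makes at most D queries; at most c of them precede the next sink and at
  most M precede each later one. The induction follows the termination order: on i, and on c for
  fixed i.\<close>

lemma max_queries_local_search:
  "max_queries orc (local_search out n k M D x i c U E T) (D * (c + i * (M + 1)))"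
proof (induction i arbitrary: c U E T)
  case (Suc i)
  note outer = Suc.IH
  show ?case
  proof (induction c arbitrary: U E rule: less_induct)
    case (less c)
    define R where "R = near_side n x E T"
    define w where "w = (SOME w. w \<in> R \<and> w \<notin> U)"
    define f where "f = (\<lambda>N. case N of
        None \<Rightarrow> local_search out n k M D x i M U E (w # T)
      | Some S \<Rightarrow> local_search out n k M D x (Suc i) (c - 1) (insert w U) (E \<union> {w} \<times> S) T)"
    consider "small_cut n k U E" | "\<not> small_cut n k U E" "c = 0 \<or> M \<le> card (R \<inter> U)"
      | "\<not> small_cut n k U E" "c \<noteq> 0" "card (R \<inter> U) < M" by fastforce
    then show ?case
    proof cases
      case 1
      then show ?thesis by simp
    next
      case 2
      have "max_queries orc (local_search out n k M D x i M U E (u # T)) (D * (c + Suc i * (M + 1)))" for u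
        by (rule max_queries_mono[OF outer]) (intro mult_le_mono2, simp)
      then show ?thesis using 2 by (auto simp flip: R_def intro: max_queries_Random)
    next
      case 3
      have "max_queries orc (f N) (D * (c - 1 + Suc i * (M + 1)))" for N
      proof (cases N)
        case None
        show ?thesis unfolding f_def None option.case
          by (rule max_queries_mono[OF outer]) (intro mult_le_mono2, simp)
      next
        case (Some S)
        show ?thesis unfolding f_def Some option.case by (rule less.IH) (use 3 in simp)
      qed
      then have "max_queries orc (fetch_nbrs out w D 0 {} f) (D + D * (c - 1 + Suc i * (M + 1)))"
        by (rule max_queries_fetch_nbrs)
      moreover have "D + D * (c - 1 + Suc i * (M + 1)) = D * (c + Suc i * (M + 1))"
        using 3(2) by (cases c) auto
      moreover have "local_search out n k M D x (Suc i) c U E T = fetch_nbrs out w D 0 {} f"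
        unfolding f_def w_def R_def
        by (subst local_search.simps(2))
          (use 3 in \<open>simp add: R_def not_le Let_def del: local_search.simps(2)\<close>)
      ultimately show ?thesis by (simp only:)
    qed
  qed
qed simp

context nbr_oracle
begin

lemma nbrs_explored:
  assumes "E = {e \<in> E0. fst e \<in> U}" "A \<subseteq> U"
  shows "nbrs E A = nbrs E0 A"
  using assms unfolding nbrs_def Image_def by auto

lemma explored_insert:
  "{e \<in> E0. fst e \<in> U} \<union> {w} \<times> E0 `` {w} = {e \<in> E0. fst e \<in> insert w U}"
  by auto

text \<open>Rejection needs a \<open>small_cut\<close>, whose neighbourhood in E is its
  neighbourhood in \<open>E0\<close> by the invariant on E and U; the first assumption excludes such
  cuts.\<close>

lemma local_search_one_sided:
  assumes "\<And>A. A \<subseteq> {..<n} \<Longrightarrow> A \<noteq> {} \<Longrightarrow> card (nbrs E0 A) < k \<Longrightarrow> n \<le> card A + card (nbrs E0 A)"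
    and "E = {e \<in> E0. fst e \<in> U}"
  shows "accept_prob orc (local_search out n k M D x i c U E T) = 1"
  using assms(2)
proof (induction i arbitrary: c U E T)
  case (Suc i)
  note outer = Suc.IH
  show ?case using Suc.prems
  proof (induction c arbitrary: U E rule: less_induct)
    case (less c)
    define R where "R = near_side n x E T"
    define w where "w = (SOME w. w \<in> R \<and> w \<notin> U)"
    have no_cut: "\<not> small_cut n k U E"
      using assms(1) nbrs_explored[OF less.prems] unfolding small_cut_def by (metis le_inf_iff not_le)
    \<comment> \<open>The sampled set may be empty and w an arbitrary default value here; this is
      harmless because the invariant persists and every continuation accepts with probability
      1.\<close>
    show ?case
    proof (cases "c = 0 \<or> M \<le> card (R \<inter> U)")
      case True
      then show ?thesis using no_cut outer[OF less.prems] by (simp flip: R_def)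
    next
      case False
      have "accept_prob orc (local_search out n k M D x (Suc i) (c - 1) (insert w U)
          (E \<union> {w} \<times> E0 `` {w}) T) = 1"
        by (rule less.IH) (use False explored_insert less.prems in auto)
      then show ?thesis
        using no_cut outer[OF less.prems] False
        by (subst local_search.simps(2))
          (simp add: accept_prob_fetch_nbrs Let_def flip: R_def w_def del: local_search.simps(2))
    qed
  qed
qed simp

text \<open>Each of the i sinks still to come falls into L with probability at most
  \<open>r / M = 1 / (4 * k)\<close>. The last invariant guarantees that once c is used up, at least
  M explored vertices of the near side are available for sampling.\<close>

lemma local_search_finds_cut:
  assumes k: "1 \<le> k" and x: "x \<in> L" and L: "L \<subseteq> {..<n}" "card L \<le> r" "card (nbrs E0 L) < k"
    and deg: "\<And>v. v \<in> L \<Longrightarrow> card (E0 `` {v}) < D"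
    and M: "M = 4 * k * r" "M + k \<le> n"
    and inv: "E = {e \<in> E0. fst e \<in> U}" "U \<subseteq> {..<n}" "set T \<inter> L = {}" "length T + i = k"
      "\<And>A. x \<in> A \<Longrightarrow> A \<subseteq> {..<n} \<Longrightarrow> length T \<le> cut_cost E T A"
      "M \<le> card (near_side n x E T \<inter> U) + c"
  shows "accept_prob orc (local_search out n k M D x i c U E T) \<le> real i / (4 * real k)"
  using inv
proof (induction i arbitrary: c U E T)
  case 0
  have "finite E" "E \<subseteq> E0" using 0(1) finite_E0 by auto
  \<comment> \<open>With k sinks outside L, every cut around x would cost at least k, whereas L
    costs only its fewer than k neighbours.\<close>
  have "filter (\<lambda>u. u \<in> L) T = []" using 0(3) by (auto simp: filter_empty_conv)
  then have "cut_cost E T L = card (nbrs E L)" by (simp add: cut_cost_def)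
  also have "\<dots> \<le> card (nbrs E0 L)" by (rule card_nbrs_mono[OF finite_E0 \<open>E \<subseteq> E0\<close>])
  finally have False using 0(4) 0(5)[OF x L(1)] L(3) by simp
  then show ?case ..
next
  case (Suc i)
  note outer = Suc.IH
  have pos: "0 < M" using L(1,2) x k M(1) finite_subset[OF L(1)] by (auto simp: card_gt_0_iff intro!: gr0I)
  show ?case using Suc.prems
  proof (induction c arbitrary: U E rule: less_induct)
    case (less c)
    define R where "R = near_side n x E T"
    define w where "w = (SOME w. w \<in> R \<and> w \<notin> U)"
    have E: "finite E" "E \<subseteq> E0" "E \<subseteq> {..<n} \<times> {..<n}" using less.prems(1) finite_E0 E0_sub by auto
    have "x < n" using x L by auto
    have R: "R \<subseteq> {..<n}" unfolding R_def by (rule near_side_subset[OF \<open>x < n\<close> E(3)])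
    have "finite R" using R finite_subset by blast
    have add_sink: "accept_prob orc (local_search out n k M D x i M U E (u # T)) \<le> i / (4 * real k)"
      if "u \<in> R" "u \<notin> L" for u
    proof (rule outer)
      show "length (u # T) \<le> cut_cost E (u # T) A" if "x \<in> A" "A \<subseteq> {..<n}" for A
        using cut_cost_add_sink[OF \<open>u \<in> R\<close>[unfolded R_def] that] less.prems(5)[OF that] by simp
    qed (use less.prems that in auto)
    consider "small_cut n k U E" | "\<not> small_cut n k U E" "c = 0 \<or> M \<le> card (R \<inter> U)"
      | "\<not> small_cut n k U E" "c \<noteq> 0" "card (R \<inter> U) < M" by fastforce
    then show ?case
    proof cases
      case 1
      then show ?thesis by simp
    next
      case 2
      then have M_le: "M \<le> card (R \<inter> U)" using less.prems(6) by (auto simp flip: R_def)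
      define B where "B = R \<inter> U"
      have B: "finite B" "B \<noteq> {}" "M \<le> card B" "B \<subseteq> R"
        using \<open>finite R\<close> M_le pos by (auto simp: B_def)
      let ?p = "\<lambda>u. accept_prob orc (local_search out n k M D x i M U E (u # T))"
      \<comment> \<open>A sink drawn inside L may spoil the search, so its branch is bounded by
        1.\<close>
      have "sum ?p B \<le> (\<Sum>u\<in>B. indicator L u + i / (4 * real k))"
        using add_sink accept_prob_le_1 B(4)
        by (intro sum_mono) (auto simp: indicator_def intro: add_increasing2)
      also have "\<dots> = card (B \<inter> L) + card B * (i / (4 * real k))"
        using B(1) by (simp add: sum.distrib indicator_def sum.If_cases Int_def)
      also have "real (card (B \<inter> L)) \<le> card B * (1 / (4 * real k))"
      proof -
        have "card (B \<inter> L) \<le> r" using L finite_subset[OF L(1)] by (meson card_mono finite_lessThan inf_le2 le_trans)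
        then have "4 * k * card (B \<inter> L) \<le> card B" using B(3) M(1)
          by (meson le_trans mult_le_mono2)
        then have "real (4 * k * card (B \<inter> L)) \<le> real (card B)" by (rule of_nat_mono)
        then show ?thesis using k by (simp add: field_simps)
      qed
      finally have "sum ?p B \<le> card B * (Suc i / (4 * real k))" by (simp add: field_simps add_divide_distrib)
      then have "sum ?p B / card B \<le> Suc i / (4 * real k)"
        using B(1,2) by (simp add: divide_le_eq card_gt_0_iff mult.commute)
      then show ?thesis using 2 B by (simp add: integral_pmf_of_set flip: R_def B_def)
    next
      case 3
      \<comment> \<open>A fully explored near side would itself be a certificate: it has at most
        \<open>length T < k\<close> neighbours and fewer than M vertices, and
        \<open>M + k \<le> n\<close> leaves a vertex outside.\<close>
      have "R - U \<noteq> {}"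
      proof
        assume "R - U = {}"
        then have "R \<subseteq> U" by blast
        have "card R < M" using 3(3) \<open>R \<subseteq> U\<close> by (simp add: Int_absorb2)
        moreover have "card (nbrs E R) \<le> length T"
          using cut_cost_near_side[OF \<open>x < n\<close> E(3) less.prems(5)] by (simp add: R_def cut_cost_def)
        moreover have "length T < k" using less.prems(4) by simp
        moreover have "x \<in> R" by (auto simp: R_def near_side_def)
        ultimately have "small_cut n k U E"
          unfolding small_cut_def using M(2) R \<open>R \<subseteq> U\<close> by (intro exI[of _ R]) auto
        then show False using 3 by simp
      qed
      then have w: "w \<in> R" "w \<notin> U"
        using someI_ex[of "\<lambda>w. w \<in> R \<and> w \<notin> U"] by (auto simp: w_def)
      define U' E' where "U' = insert w U" and "E' = E \<union> {w} \<times> E0 `` {w}"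
      have E': "E' = {e \<in> E0. fst e \<in> U'}"
        using explored_insert less.prems(1) by (simp add: U'_def E'_def)
      have "finite E'" using finite_E0 E' by simp
      \<comment> \<open>The new arcs only raise cut costs and enlarge the near side; w becomes an
        explored vertex of it, which pays for the decrease of c.\<close>
      have light: "accept_prob orc (local_search out n k M D x (Suc i) (c - 1) U' E' T) \<le> Suc i / (4 * real k)"
      proof (rule less.IH)
        show "length T \<le> cut_cost E' T A" if "x \<in> A" "A \<subseteq> {..<n}" for A
          using less.prems(5)[OF that] card_nbrs_mono[OF \<open>finite E'\<close>, of E A]
          by (simp add: cut_cost_def E'_def)
        have "insert w (R \<inter> U) \<subseteq> near_side n x E' T \<inter> U'"
          using near_side_mono[OF _ \<open>finite E'\<close>, of E n x T] w by (auto simp: R_def E'_def U'_def)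
        moreover have "finite (near_side n x E' T \<inter> U')"
          using less.prems(2) w R finite_subset by (fastforce simp: U'_def)
        ultimately have "card (insert w (R \<inter> U)) \<le> card (near_side n x E' T \<inter> U')"
          by (rule card_mono[rotated])
        then show "M \<le> card (near_side n x E' T \<inter> U') + (c - 1)"
          using less.prems(6) w \<open>finite R\<close> 3(2) by (simp flip: R_def)
      qed (use 3 less.prems E' w R in \<open>auto simp: U'_def\<close>)
      show ?thesis
      proof (cases "card (E0 `` {w}) < D")
        case True
        then show ?thesis using 3 light
          by (subst local_search.simps(2))
            (simp add: accept_prob_fetch_nbrs not_le Let_def U'_def E'_def flip: R_def w_def
              del: local_search.simps(2))
      next
        case False
        then have "w \<notin> L" using deg by blast
        have "real i / (4 * real k) \<le> Suc i / (4 * real k)" by (simp add: divide_right_mono)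
        with add_sink[OF w(1) \<open>w \<notin> L\<close>]
        have "accept_prob orc (local_search out n k M D x i M U E (w # T)) \<le> Suc i / (4 * real k)"
          by linarith
        then show ?thesis using 3 False
          by (subst local_search.simps(2))
            (simp add: accept_prob_fetch_nbrs not_le Let_def flip: R_def w_def
              del: local_search.simps(2))
      qed
    qed
  qed
qed

end

section \<open>Sampling over scales\<close>

definition trial :: "nat \<Rightarrow> nat \<Rightarrow> nat \<Rightarrow> nat \<Rightarrow> bool \<Rightarrow> algorithm" where
  "trial n k r D out = Random (pmf_of_set {..<n})
     (\<lambda>x. local_search out n k (4 * k * r) D x k (4 * k * r) {} {} [])"

lemma max_queries_trial:
  assumes "1 \<le> k" "1 \<le> r"
  shows "max_queries orc (trial n k r D out) (9 * k\<^sup>2 * r * D)"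
  unfolding trial_def
proof (intro max_queries_Random max_queries_mono[OF max_queries_local_search])
  \<comment> \<open>The 9 is 4 + 4 + 1, one summand for each of \<open>4 * k * r\<close>,
    \<open>4 * k * k * r\<close> and k.\<close>
  have "k \<le> k * k * r" "k * r \<le> k * k * r" using assms by auto
  moreover have "4 * k * r + k * (4 * k * r + 1) = 4 * (k * r) + 4 * (k * k * r) + k"
    "9 * k\<^sup>2 * r = 9 * (k * k * r)"
    by (simp_all add: power2_eq_square algebra_simps)
  ultimately have "4 * k * r + k * (4 * k * r + 1) \<le> 9 * k\<^sup>2 * r" by linarith
  then show "D * (4 * k * r + k * (4 * k * r + 1)) \<le> 9 * k\<^sup>2 * r * D"
    by (metis mult.commute mult_le_mono2)
qed

context nbr_oracle
begin

lemma trial_one_sided: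
  assumes "\<And>A. A \<subseteq> {..<n} \<Longrightarrow> A \<noteq> {} \<Longrightarrow> card (nbrs E0 A) < k \<Longrightarrow> n \<le> card A + card (nbrs E0 A)"
  shows "accept_prob orc (trial n k r D out) = 1"
proof -
  have "accept_prob orc (local_search out n k (4 * k * r) D x k (4 * k * r) {} {} []) = 1" for x
    by (rule local_search_one_sided[OF assms]) auto
  then show ?thesis by (simp add: trial_def)
qed

text \<open>A start in B accepts with probability at most \<open>k / (4 * k) = 1 / 4\<close>, any
  other with at most 1; the bound is the average over the start.\<close>

lemma trial_accept_prob_le:
  assumes "1 \<le> k" "4 * k * r + k \<le> n" "B \<subseteq> {..<n}"
    and good: "\<And>x. x \<in> B \<Longrightarrow> \<exists>L. x \<in> L \<and> L \<subseteq> {..<n} \<and> card L \<le> r \<and> card (nbrs E0 L) < k \<and>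
      (\<forall>v\<in>L. card (E0 `` {v}) < D)"
  shows "accept_prob orc (trial n k r D out) \<le> 1 - 3 / 4 * (card B / n)"
proof -
  let ?p = "\<lambda>x. accept_prob orc (local_search out n k (4 * k * r) D x k (4 * k * r) {} {} [])"
  have "0 < n" using assms by simp
  have fin: "finite B" using assms(3) finite_subset by blast
  have "?p x \<le> 1 / 4" if x: "x \<in> B" for x
  proof -
    obtain L where "x \<in> L" "L \<subseteq> {..<n}" "card L \<le> r" "card (nbrs E0 L) < k"
      "\<forall>v\<in>L. card (E0 `` {v}) < D" using good[OF x] by blast
    then have "?p x \<le> real k / (4 * real k)"
      by (intro local_search_finds_cut[of k x L r]) (use assms in auto)
    then show ?thesis using assms(1) by simp
  qed
  then have "sum ?p {..<n} \<le> (\<Sum>x<n. 1 - 3 / 4 * indicator B x)"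
    using accept_prob_le_1 by (intro sum_mono) (auto simp: indicator_def)
  also have "\<dots> = n - 3 / 4 * card B"
    using assms(3) fin
    by (simp add: sum_subtractf indicator_def Int_absorb1 sum.If_cases flip: sum_distrib_left del: times_divide_eq_left)
  finally show ?thesis using \<open>0 < n\<close>
    by (simp add: trial_def integral_pmf_of_set lessThan_empty_iff field_simps)
qed

end

text \<open>The scales are the j with \<open>2 ^ j \<le> 2 * s\<close>: at least half of n / s disjoint subsets of an
  n-element set have size at most 2 s.\<close>

definition num_scales :: "real \<Rightarrow> nat" where
  "num_scales s = Suc (nat \<lfloor>log 2 (2 * s)\<rfloor>)"

text \<open>On a scale j rich in small sets, a trial rejects with probability at least
  \<open>3 / 4 * 2 ^ j / (2 * s * num_scales s)\<close>. The factor 6 raises the expected number of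
  rejections to at least 9 / 4, enough for error 1 / 3.\<close>

definition num_samples :: "real \<Rightarrow> nat \<Rightarrow> nat" where
  "num_samples s j = nat \<lceil>6 * s * num_scales s / 2 ^ j\<rceil>"

text \<open>Scale j aims at sets of at least \<open>2 ^ j\<close> and fewer than
  \<open>2 ^ Suc j\<close> vertices. Both directions are tried since either kind of neighbourhood
  may be the small one.\<close>

definition scale_tester :: "nat \<Rightarrow> nat \<Rightarrow> real \<Rightarrow> (nat \<Rightarrow> nat) \<Rightarrow> nat \<Rightarrow> algorithm" where
  "scale_tester n k s D j = run_all (replicate (num_samples s j)
     (and_then (trial n k (2 ^ Suc j) (D (2 ^ Suc j)) True)
       (trial n k (2 ^ Suc j) (D (2 ^ Suc j)) False)))"

definition sampling_tester :: "nat \<Rightarrow> nat \<Rightarrow> real \<Rightarrow> (nat \<Rightarrow> nat) \<Rightarrow> algorithm" where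
  "sampling_tester n k s D = run_all (map (scale_tester n k s D) [0..<num_scales s])"

text \<open>Computation is free, so the final verdict decides connectivity exactly. If a list does
  not end within D queries the run accepts, which keeps the error one-sided.\<close>

primrec read_all :: "nat \<Rightarrow> nat \<Rightarrow> nat \<Rightarrow> nat list \<Rightarrow> nat rel \<Rightarrow> algorithm" where
  "read_all n k D [] E = Answer (k_vertex_connected k \<lparr>pverts = {..<n}, parcs = E\<rparr>)"
| "read_all n k D (v # vs) E = fetch_nbrs True v D 0 {} (\<lambda>N. case N of
      None \<Rightarrow> Answer True
    | Some S \<Rightarrow> read_all n k D vs (E \<union> {v} \<times> S))"

text \<open>A graph that needs more than t modifications, \<open>t \<ge> 2 * k\<^sup>2\<close>, has at least \<open>t / (4 * k) = n / s\<close>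
  disjoint small-neighbourhood sets. The constant 68 makes n large enough for the sets found by the
  local search, of size less than \<open>M \<le> 16 * k * s\<close>, to be certificates.\<close>

definition connectivity_tester ::
  "nat \<Rightarrow> nat \<Rightarrow> real \<Rightarrow> (nat \<Rightarrow> nat) \<Rightarrow> nat \<Rightarrow> algorithm" where
  "connectivity_tester n k t D D' =
     (if n \<le> k then Answer False
      else if t < 68 * (real k)\<^sup>2 then read_all n k D' [0..<n] {}
      else let s = 4 * real k * real n / t in
        if s < 1 then Answer True else sampling_tester n k s D)"

section \<open>Scales, and the cost of sampling over them\<close>

lemma num_scales_bounds:
  fixes s :: real
  assumes "1 \<le> s"
  shows "real (num_scales s) \<le> log 2 (4 * s)" "2 ^ num_scales s \<le> 4 * s"
    and "\<And>j. 2 ^ j \<le> 2 * s \<longleftrightarrow> j < num_scales s"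
proof -
  have s: "0 < 2 * s" "0 \<le> log 2 (2 * s)" using assms by auto
  have "log 2 (4 * s) = log 2 2 + log 2 (2 * s)"
    using assms log_mult[of 2 2 "2 * s"] by simp
  then show "real (num_scales s) \<le> log 2 (4 * s)" using s unfolding num_scales_def by simp
  show iff: "2 ^ j \<le> 2 * s \<longleftrightarrow> j < num_scales s" for j
  proof -
    have "2 ^ j \<le> 2 * s \<longleftrightarrow> real j \<le> log 2 (2 * s)"
      using s(1) by (simp add: le_log_iff powr_realpow)
    also have "\<dots> \<longleftrightarrow> j < num_scales s"
      using s(2) unfolding num_scales_def by (simp add: less_Suc_eq_le le_nat_iff le_floor_iff)
    finally show ?thesis .
  qed
  have "2 ^ nat \<lfloor>log 2 (2 * s)\<rfloor> \<le> 2 * s" using iff by (simp add: num_scales_def)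
  then show "2 ^ num_scales s \<le> 4 * s" by (simp add: num_scales_def)
qed

text \<open>By disjointness at most \<open>n / (2 * s)\<close> sets have more than
  \<open>2 * s\<close> elements, so at least \<open>n / (2 * s)\<close> are spread over the scales.
  Some scale gets the average share, and each of its sets has at least \<open>2 ^ j\<close>
  vertices.\<close>

lemma exists_popular_scale:
  fixes \<X> :: "nat set set" and s :: real
  assumes \<X>: "disjoint \<X>" "\<X> \<subseteq> Pow {..<n} - {{}}" and s: "1 \<le> s" and "0 < n"
    and many: "n / s \<le> card \<X>"
  shows "\<exists>j < num_scales s.
    2 ^ j * n / (2 * s * num_scales s) \<le> card (\<Union>{X \<in> \<X>. 2 ^ j \<le> card X \<and> card X < 2 ^ Suc j})"
proof -
  define J where "J = num_scales s"
  define C where "C j = {X \<in> \<X>. 2 ^ j \<le> card X \<and> card X < 2 ^ Suc j}" for j :: nat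
  define big where "big = {X \<in> \<X>. 2 * s < card X}"
  have "finite \<X>" using \<X>(2) by (rule finite_subset) simp
  have fin: "finite X" if "X \<in> \<X>" for X using that \<X>(2) finite_subset by blast
  have card_Union: "card (\<Union>F) = sum card F" if "F \<subseteq> \<X>" for F
    by (rule card_Union_disjoint) (use that \<X>(1) fin in \<open>auto simp: disjoint_def pairwise_def disjnt_def\<close>)
  have "2 * s * card big = sum (\<lambda>_. 2 * s) big" by simp
  also have "\<dots> \<le> (\<Sum>X\<in>big. real (card X))" by (intro sum_mono) (auto simp: big_def)
  also have "\<dots> = card (\<Union>big)" by (subst card_Union) (auto simp: big_def)
  also have "\<dots> \<le> n"
    using card_mono[of "{..<n}" "\<Union>big"] \<X>(2) by (fastforce simp: big_def)
  finally have "card big \<le> n / (2 * s)" using s by (simp add: field_simps)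
  moreover have "\<X> \<subseteq> big \<union> (\<Union>j<J. C j)"
  proof
    fix X assume X: "X \<in> \<X>"
    then have "1 \<le> card X" using fin[OF X] \<X>(2) by (simp add: Suc_le_eq card_gt_0_iff) blast
    then obtain j where j: "2 ^ j \<le> card X" "card X < 2 ^ Suc j"
      using ex_power_ivl1[of 2 "card X"] by auto
    show "X \<in> big \<union> (\<Union>j<J. C j)"
    proof (cases "X \<in> big")
      case False
      have "real (2 ^ j) \<le> real (card X)" using j(1) by (rule of_nat_mono)
      also have "\<dots> \<le> 2 * s" using False X by (simp add: big_def)
      finally have "2 ^ j \<le> 2 * s" by simp
      then have "j < J" using num_scales_bounds(3)[OF s] by (simp add: J_def)
      then show ?thesis using X j by (auto simp: C_def)
    qed simp
  qed
  then have "card \<X> \<le> card big + (\<Sum>j<J. card (C j))"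
    using \<open>finite \<X>\<close>
    by (intro order_trans[OF card_mono order_trans[OF card_Un_le add_left_mono[OF card_UN_le]]])
      (auto simp: big_def C_def)
  then have "real (card \<X>) \<le> real (card big) + (\<Sum>j<J. real (card (C j)))"
    by (metis of_nat_add of_nat_le_iff of_nat_sum)
  moreover have "n / s = n / (2 * s) + n / (2 * s)" using s by (simp add: field_simps)
  ultimately have sum_C: "n / (2 * s) \<le> (\<Sum>j<J. real (card (C j)))"
    using many by linarith
  have "0 < J" by (simp add: J_def num_scales_def)
  have "\<exists>j<J. n / (2 * s * J) \<le> card (C j)"
  proof (rule ccontr)
    assume "\<not> ?thesis"
    then have "(\<Sum>j<J. real (card (C j))) < (\<Sum>j<J. n / (2 * s * J))"
      using \<open>0 < J\<close> by (intro sum_strict_mono) auto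
    then show False using sum_C \<open>0 < J\<close> by simp
  qed
  then obtain j where j: "j < J" "n / (2 * s * J) \<le> card (C j)" by blast
  have "2 ^ j * n / (2 * s * J) = 2 ^ j * (n / (2 * s * J))" by simp
  also have "\<dots> \<le> 2 ^ j * real (card (C j))" using j(2) by (intro mult_left_mono) auto
  also have "\<dots> = real (\<Sum>X\<in>C j. 2 ^ j)" by (simp add: mult.commute)
  also have "\<dots> \<le> real (\<Sum>X\<in>C j. card X)" by (intro of_nat_mono sum_mono) (auto simp: C_def)
  also have "(\<Sum>X\<in>C j. card X) = card (\<Union>(C j))" by (rule card_Union[symmetric]) (auto simp: C_def)
  finally show ?thesis using j(1) by (auto simp: J_def C_def)
qed

lemma accept_prob_scale_tester:
  "accept_prob orc (scale_tester n k s D j) =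
    (accept_prob orc (trial n k (2 ^ Suc j) (D (2 ^ Suc j)) True) *
     accept_prob orc (trial n k (2 ^ Suc j) (D (2 ^ Suc j)) False)) ^ num_samples s j"
  by (simp add: scale_tester_def accept_prob_run_all accept_prob_and_then)

lemma prod_list_le_member:
  fixes xs :: "real list"
  assumes "\<And>y. y \<in> set xs \<Longrightarrow> 0 \<le> y \<and> y \<le> 1" "x \<in> set xs"
  shows "prod_list xs \<le> x"
proof -
  have "0 \<le> prod_list ys \<and> prod_list ys \<le> 1" if "set ys \<subseteq> set xs" for ys
    using that assms(1) by (induction ys) (auto simp: mult_le_one)
  moreover obtain ys zs where "xs = ys @ x # zs" using assms(2) by (meson split_list)
  ultimately have "prod_list ys \<le> 1" "0 \<le> prod_list ys" "prod_list zs \<le> 1" "0 \<le> prod_list zs" "0 \<le> x"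
    using assms by auto
  then have "prod_list ys * (x * prod_list zs) \<le> 1 * (x * 1)" by (intro mult_mono) auto
  then show ?thesis using \<open>xs = ys @ x # zs\<close> by simp
qed

text \<open>Up to rounding, the number of samples falls like \<open>1 / 2 ^ j\<close> while a trial
  costs in proportion to \<open>2 ^ j\<close>, so the scales differ only in the degree budgets. Here
  288 is 8 from the samples times 36 from two trials with factor 9 and size bound
  \<open>2 * 2 ^ j\<close>.\<close>

lemma max_queries_sampling_tester:
  fixes s :: real
  assumes "1 \<le> k" "1 \<le> s"
  shows "\<exists>B. max_queries orc (sampling_tester n k s D) B \<and>
    B \<le> 288 * (real k)\<^sup>2 * s * num_scales s * (\<Sum>j<num_scales s. real (D (2 ^ Suc j)))"
proof -
  define J where "J = num_scales s"
  define b where "b j = 9 * k\<^sup>2 * 2 ^ Suc j * D (2 ^ Suc j)" for j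
  have scale: "max_queries orc (scale_tester n k s D j) (num_samples s j * (b j + b j))" for j
  proof -
    have "max_queries orc (scale_tester n k s D j)
      (sum_list (map (\<lambda>_. b j + b j) (replicate (num_samples s j)
     (and_then (trial n k (2 ^ Suc j) (D (2 ^ Suc j)) True)
       (trial n k (2 ^ Suc j) (D (2 ^ Suc j)) False)))))"
      unfolding scale_tester_def b_def
    proof (rule max_queries_run_all)
      fix A assume "A \<in> set (replicate (num_samples s j)
        (and_then (trial n k (2 ^ Suc j) (D (2 ^ Suc j)) True)
          (trial n k (2 ^ Suc j) (D (2 ^ Suc j)) False)))"
      then have "A = and_then (trial n k (2 ^ Suc j) (D (2 ^ Suc j)) True)
          (trial n k (2 ^ Suc j) (D (2 ^ Suc j)) False)" by simp
      then show "max_queries orc A (9 * k\<^sup>2 * 2 ^ Suc j * D (2 ^ Suc j) + 9 * k\<^sup>2 * 2 ^ Suc j * D (2 ^ Suc j))"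
        by (simp only:) (intro max_queries_and_then max_queries_trial assms(1) one_le_power one_le_numeral)
    qed
    then show ?thesis by (simp add: sum_list_replicate)
  qed
  \<comment> \<open>Rounding up adds at most one sample, hence at most
    \<open>2 ^ j \<le> 2 * s * J\<close> to the product: 8 = 6 + 2.\<close>
  have samples: "num_samples s j * 2 ^ j \<le> 8 * s * J" if "j < J" for j
  proof -
    have "2 ^ j \<le> 2 * s" using num_scales_bounds(3)[OF assms(2)] that by (simp add: J_def)
    also have "\<dots> \<le> 2 * s * J" using assms(2) that by simp
    finally have "2 ^ j \<le> 2 * s * J" .
    have "num_samples s j \<le> 6 * s * J / 2 ^ j + 1"
      unfolding num_samples_def J_def[symmetric] using assms(2)
      by simp
    then have "real (num_samples s j) * 2 ^ j \<le> (6 * s * J / 2 ^ j + 1) * 2 ^ j"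
      by (rule mult_right_mono) simp
    also have "\<dots> = 6 * s * J + 2 ^ j" by (simp add: field_simps)
    finally show ?thesis using \<open>2 ^ j \<le> 2 * s * J\<close> by simp
  qed
  have "max_queries orc (sampling_tester n k s D) (\<Sum>j<J. num_samples s j * (b j + b j))"
  proof -
    have "max_queries orc (run_all (map (scale_tester n k s D) js))
        (\<Sum>j\<leftarrow>js. num_samples s j * (b j + b j))" for js
      using scale by (induction js) (auto simp: run_all_def intro!: max_queries_and_then)
    from this[of "[0..<J]"] show ?thesis unfolding sampling_tester_def J_def
      by (simp add: interv_sum_list_conv_sum_set_nat lessThan_atLeast0)
  qed
  moreover have "real (\<Sum>j<J. num_samples s j * (b j + b j)) \<le>
      (\<Sum>j<J. 288 * (real k)\<^sup>2 * s * J * D (2 ^ Suc j))"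
    unfolding of_nat_sum
  proof (rule sum_mono)
    fix j assume "j \<in> {..<J}"
    then have "(num_samples s j * 2 ^ j) * (36 * (real k)\<^sup>2 * D (2 ^ Suc j))
      \<le> (8 * s * J) * (36 * (real k)\<^sup>2 * D (2 ^ Suc j))"
      using samples by (intro mult_right_mono) auto
    then show "real (num_samples s j * (b j + b j)) \<le> 288 * (real k)\<^sup>2 * s * J * D (2 ^ Suc j)"
      by (simp add: b_def algebra_simps)
  qed
  ultimately show ?thesis by (auto simp: J_def sum_distrib_left)
qed

lemma max_queries_read_all:
  "max_queries orc (read_all n k D vs E) (length vs * D)"
  by (induction vs arbitrary: E)
    (auto intro!: max_queries_fetch_nbrs split: option.split)

section \<open>The tester\<close>

text \<open>Distinct arcs listed at one vertex share that end, so their other ends are distinct; arc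
  lists thus become neighbour lists.\<close>

lemma nbr_oracle_if_incidence_oracle:
  assumes "pair_digraph G" "pverts G = {..<n}" "incidence_oracle G orc"
  shows "\<exists>nbr_list. nbr_oracle orc out n (orient out (parcs G)) nbr_list"
proof -
  interpret pair_digraph G by fact
  obtain outs ins where
    outs: "\<And>v. distinct (outs v)" "\<And>v. set (outs v) = {e \<in> parcs G. fst e = v}"
      "\<And>v i. orc (Out_Edge v i) = entry (outs v) i" and
    ins: "\<And>v. distinct (ins v)" "\<And>v. set (ins v) = {e \<in> parcs G. snd e = v}"
      "\<And>v i. orc (In_Edge v i) = entry (ins v) i"
  proof -
    from assms(3) obtain outs ins where *:
      "\<forall>v. distinct (outs v) \<and> set (outs v) = out_arcs (with_proj G) v \<and>
        distinct (ins v) \<and> set (ins v) = in_arcs (with_proj G) v"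
      "\<forall>v i. orc (Out_Edge v i) = entry (outs v) i \<and> orc (In_Edge v i) = entry (ins v) i"
      unfolding incidence_oracle_def by blast
    show thesis by (rule that[of outs ins]) (use * in \<open>auto simp: out_arcs_def in_arcs_def\<close>)
  qed
  define arc_list where "arc_list v = (if out then outs v else ins v)" for v
  have "nbr_oracle orc out n (orient out (parcs G)) (\<lambda>v. map (other_end out) (arc_list v))"
  proof
    show "orient out (parcs G) \<subseteq> {..<n} \<times> {..<n}"
      using in_arcsD1 in_arcsD2 assms(2) by (auto simp: orient_def)
  next
    fix v
    have "inj_on (other_end out) (set (arc_list v))"
      by (auto simp: inj_on_def other_end_def arc_list_def outs ins)
    then show "distinct (map (other_end out) (arc_list v))"
      by (simp add: distinct_map) (simp add: arc_list_def outs ins)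
    show "set (map (other_end out) (arc_list v)) = orient out (parcs G) `` {v}"
      by (force simp: orient_def other_end_def arc_list_def outs ins image_iff)
    show "map_option (other_end out) (orc (edge_query out v i)) =
        entry (map (other_end out) (arc_list v)) i" for i
      by (simp add: entry_def edge_query_def arc_list_def outs ins del: split_paired_Ex)
  qed
  then show ?thesis by blast
qed

lemma accept_prob_read_all:
  assumes "nbr_oracle orc True n E0 nbr_list" "\<And>v. v \<in> set vs \<Longrightarrow> card (E0 `` {v}) < D"
  shows "accept_prob orc (read_all n k D vs E) = of_bool (k_vertex_connected k
    \<lparr>pverts = {..<n}, parcs = E \<union> {e \<in> E0. fst e \<in> set vs}\<rparr>)"
  using assms(2)
proof (induction vs arbitrary: E)
  case (Cons v vs)
  have "E \<union> {v} \<times> E0 `` {v} \<union> {e \<in> E0. fst e \<in> set vs} = E \<union> {e \<in> E0. fst e \<in> set (v # vs)}"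
    by auto
  moreover have "accept_prob orc (read_all n k D vs (E \<union> {v} \<times> E0 `` {v})) =
      of_bool (k_vertex_connected k
        \<lparr>pverts = {..<n}, parcs = E \<union> {v} \<times> E0 `` {v} \<union> {e \<in> E0. fst e \<in> set vs}\<rparr>)"
    by (rule Cons.IH) (use Cons.prems in auto)
  moreover have "card (E0 `` {v}) < D" using Cons.prems by simp
  ultimately show ?case
    by (simp only: read_all.simps nbr_oracle.accept_prob_fetch_nbrs[OF assms(1)] if_True option.case)
qed simp

text \<open>Uses \<open>1 - \<delta> \<le> exp (- \<delta>)\<close> and
  \<open>exp 2 \<ge> 3\<close>.\<close>

lemma power_one_minus_le_third:
  assumes "0 \<le> a" "a \<le> 1 - (\<delta> :: real)" "2 \<le> \<delta> * real N"
  shows "a ^ N \<le> 1 / 3"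
proof -
  have "a \<le> exp (- \<delta>)" using assms(2) exp_ge_add_one_self[of "- \<delta>"] by simp
  then have "a ^ N \<le> exp (- \<delta>) ^ N" using assms(1) by (rule power_mono)
  also have "\<dots> = exp (- (\<delta> * N))" by (simp add: exp_of_nat_mult[symmetric] mult.commute)
  also have "\<dots> \<le> exp (- 2)" using assms(3) by simp
  also have "\<dots> \<le> 1 / 3" using exp_ge_add_one_self[of 2] by (simp add: exp_minus field_simps)
  finally show ?thesis .
qed

lemma card_disjoint_nonempty_le:
  assumes "disjoint \<X>" "\<X> \<subseteq> Pow {..<n :: nat} - {{}}"
  shows "card \<X> \<le> n"
proof -
  have fin: "finite X" "card X \<ge> 1" if "X \<in> \<X>" for X
  proof -
    show "finite X" using that assms(2) finite_subset by blast
    then show "card X \<ge> 1" using that assms(2) by (auto simp: Suc_le_eq card_gt_0_iff)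
  qed
  have "card \<X> = (\<Sum>X\<in>\<X>. 1)" by simp
  also have "\<dots> \<le> sum card \<X>" using fin(2) by (rule sum_mono)
  also have "\<dots> = card (\<Union>\<X>)"
    by (rule card_Union_disjoint[symmetric]) (use assms(1) fin in \<open>auto simp: disjoint_def pairwise_def disjnt_def\<close>)
  also have "\<dots> \<le> card {..<n}" by (rule card_mono) (use assms(2) in auto)
  finally show ?thesis by simp
qed

section \<open>Correctness of the tester for abstract degree bounds\<close>

text \<open>The two models share this interface and differ in the degree budgets. The bounds are
  strict since seeing the end of a list takes one query more than its length. D speaks only of
  vertices in sets with fewer than k neighbours, whose degrees are controlled even without a global
  degree bound.\<close>

locale tester_input =
  fixes G :: "nat pair_pre_digraph" and orc :: "query \<Rightarrow> answer" and n k :: nat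
    and D :: "nat \<Rightarrow> nat" and D' :: nat
  assumes G: "pair_digraph G" "pverts G = {..<n}" "incidence_oracle G orc"
    and k: "1 \<le> k"
    and D': "\<And>v. card (parcs G `` {v}) < D'"
    and D: "\<And>out X v r. X \<subseteq> {..<n} \<Longrightarrow> card (nbrs (orient out (parcs G)) X) < k \<Longrightarrow> v \<in> X \<Longrightarrow>
      card X \<le> r \<Longrightarrow> card (orient out (parcs G) `` {v}) < D r"
begin

lemma G_eq: "G = \<lparr>pverts = {..<n}, parcs = parcs G\<rparr>"
  using G(2) by (cases G) auto

lemma read_all_exact:
  "accept_prob orc (read_all n k D' [0..<n] {}) = of_bool (k_vertex_connected k G)"
proof -
  obtain nbr_list where o: "nbr_oracle orc True n (parcs G) nbr_list"
    using nbr_oracle_if_incidence_oracle[OF G, of True] by (auto simp: orient_def)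
  have "{e \<in> parcs G. fst e \<in> set [0..<n]} = parcs G"
    using nbr_oracle.E0_sub[OF o] by auto
  then show ?thesis using accept_prob_read_all[OF o, of "[0..<n]" D' k "{}"] D' G_eq by simp
qed

lemma sampling_tester_one_sided:
  assumes "k_vertex_connected k G"
  shows "accept_prob orc (sampling_tester n k s D) = 1"
proof -
  have "accept_prob orc (trial n k r d out) = 1" for r d out
  proof -
    obtain nbr_list where "nbr_oracle orc out n (orient out (parcs G)) nbr_list"
      using nbr_oracle_if_incidence_oracle[OF G, of out] by blast
    then interpret nbr_oracle orc out n "orient out (parcs G)" nbr_list .
    show ?thesis
    proof (rule trial_one_sided)
      fix A assume A: "A \<subseteq> {..<n}" "A \<noteq> {}" "card (nbrs (orient out (parcs G)) A) < k"
      have sub: "parcs G \<subseteq> pverts G \<times> pverts G"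
        using E0_sub G(2) by (auto simp: orient_def split: if_splits)
      show "n \<le> card A + card (nbrs (orient out (parcs G)) A)"
      proof (rule ccontr)
        assume "\<not> ?thesis"
        then have "\<not> k_vertex_connected k G"
          by (intro not_k_vertex_connected_if_small_nbrs[where A = A and F = "orient out (parcs G)"])
            (use A sub G(2) in \<open>auto simp: orient_def\<close>)
        with assms show False by simp
      qed
    qed
  qed
  then have "accept_prob orc (scale_tester n k s D j) = 1" for j
    by (simp add: accept_prob_scale_tester)
  moreover have "prod_list (map f js) = 1" if "\<And>j. f j = 1" for f :: "nat \<Rightarrow> real" and js
    using that by (induction js) auto
  ultimately show ?thesis by (simp add: sampling_tester_def accept_prob_run_all o_def)
qed

text \<open>Half of t absorbs \<open>k * k\<close>, so the two families together have more than
  \<open>t / (2 * k)\<close> members, and one of them has at least half of this bound.\<close>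

lemma many_small_cuts_if_far:
  assumes "k < n" "2 * (real k)\<^sup>2 \<le> t" "needs_more_modifications (k_vertex_connected k) t G"
  shows "\<exists>out \<X>. disjoint \<X> \<and> \<X> \<subseteq> Pow {..<n} - {{}} \<and>
    (\<forall>X\<in>\<X>. card (nbrs (orient out (parcs G)) X) < k) \<and> t / (4 * k) \<le> card \<X>"
proof -
  have "k < card (pverts G)" using assms(1) G(2) by simp
  from disjoint_families_if_far[OF G(1) this assms(3)] obtain \<X> \<Y> where
    \<X>: "disjoint \<X>" "\<X> \<subseteq> Pow {..<n} - {{}}" "\<forall>X\<in>\<X>. card (nbrs (orient True (parcs G)) X) < k" and
    \<Y>: "disjoint \<Y>" "\<Y> \<subseteq> Pow {..<n} - {{}}" "\<forall>X\<in>\<Y>. card (nbrs (orient False (parcs G)) X) < k" and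
    lt: "t < real (k * k + k * card \<X> + k * card \<Y>)"
    unfolding G(2) orient_def by auto
  have "t < (real k)\<^sup>2 + k * (real (card \<X>) + card \<Y>)"
    using lt by (simp add: power2_eq_square algebra_simps)
  then have "t / 2 < k * (real (card \<X>) + card \<Y>)" using assms(2) by simp
  then have "t / (2 * k) < real (card \<X>) + card \<Y>" using k by (simp add: field_simps)
  then have "t / (4 * k) \<le> card \<X> \<or> t / (4 * k) \<le> card \<Y>" by (simp add: field_simps) linarith
  then show ?thesis using \<X> \<Y> by blast
qed

text \<open>A conjunction accepts at most as often as any of its parts, so it suffices that the
  popular scale, in the direction with many small cuts, rejects often enough.\<close>

lemma sampling_tester_rejects:
  assumes "k < n" "68 * (real k)\<^sup>2 \<le> t" and s: "s = 4 * real k * real n / t" "1 \<le> s"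
    and far: "needs_more_modifications (k_vertex_connected k) t G"
  shows "accept_prob orc (sampling_tester n k s D) \<le> 1 / 3"
proof -
  have "0 < t" using assms(2) k by (auto intro: less_le_trans[rotated])
  have n_s: "n / s = t / (4 * k)" using s \<open>0 < t\<close> k assms(1) by (simp add: field_simps)
  have "2 * (real k)\<^sup>2 \<le> t" using assms(2) zero_le_power2[of "real k"] by linarith
  then obtain out \<X> where \<X>: "disjoint \<X>" "\<X> \<subseteq> Pow {..<n} - {{}}" "n / s \<le> card \<X>"
    and small: "\<And>X. X \<in> \<X> \<Longrightarrow> card (nbrs (orient out (parcs G)) X) < k"
    using many_small_cuts_if_far[OF assms(1) _ far] unfolding n_s by blast
  define J where "J = num_scales s"
  obtain j where j: "j < J" and
    many: "2 ^ j * n / (2 * s * J) \<le> card (\<Union>{X \<in> \<X>. 2 ^ j \<le> card X \<and> card X < 2 ^ Suc j})"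
    using exists_popular_scale[OF \<X>(1,2) s(2) _ \<X>(3)] assms(1) unfolding J_def by auto
  define r where "r = (2 :: nat) ^ Suc j"
  define B where "B = \<Union>{X \<in> \<X>. 2 ^ j \<le> card X \<and> card X < 2 ^ Suc j}"
  define \<delta> where "\<delta> = 3 / 4 * (2 ^ j / (2 * s * J))"
  obtain nbr_list where "nbr_oracle orc out n (orient out (parcs G)) nbr_list"
    using nbr_oracle_if_incidence_oracle[OF G, of out] by blast
  then interpret nbr_oracle orc out n "orient out (parcs G)" nbr_list .
  have "2 ^ j \<le> 2 * s" using num_scales_bounds(3)[OF s(2)] j by (simp add: J_def)
  \<comment> \<open>The left side is at most \<open>16 * k * s + k * s = 17 * k * s\<close>, and
    \<open>s = 4 * k * n / t\<close> turns the 17 into 68.\<close>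
  then have "4 * real k * (2 * 2 ^ j) + k \<le> 4 * real k * (4 * s) + k * s"
    using s(2) k by (intro add_mono mult_left_mono) auto
  also have "\<dots> = 68 * (real k)\<^sup>2 * (n / t)" by (simp add: s(1) power2_eq_square field_simps)
  also have "\<dots> \<le> t * (n / t)" using assms(2) \<open>0 < t\<close> by (intro mult_right_mono) auto
  also have "\<dots> = n" using \<open>0 < t\<close> by simp
  finally have "real (4 * k * r + k) \<le> real n" by (simp add: r_def algebra_simps)
  then have "4 * k * r + k \<le> n" by (simp only: of_nat_le_iff)
  have "accept_prob orc (trial n k r (D r) out) \<le> 1 - 3 / 4 * (card B / n)"
  proof (rule trial_accept_prob_le[OF k \<open>4 * k * r + k \<le> n\<close>])
    show "B \<subseteq> {..<n}" using \<X>(2) by (auto simp: B_def)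
    fix x assume "x \<in> B"
    then obtain X where X: "X \<in> \<X>" "x \<in> X" "card X < r" by (auto simp: B_def r_def)
    then show "\<exists>L. x \<in> L \<and> L \<subseteq> {..<n} \<and> card L \<le> r \<and> card (nbrs (orient out (parcs G)) L) < k \<and>
        (\<forall>v\<in>L. card (orient out (parcs G) `` {v}) < D r)"
      using small[OF X(1)] \<X>(2) D[OF _ small[OF X(1)], of _ r] by (intro exI[of _ X]) auto
  qed
  also have "\<dots> \<le> 1 - \<delta>"
  proof -
    have "(2 ^ j / (2 * s * J)) * n \<le> card B" using many by (simp add: B_def)
    then have "2 ^ j / (2 * s * J) \<le> card B / n"
      using assms(1) by (simp add: pos_le_divide_eq del: times_divide_eq_left)
    then show ?thesis unfolding \<delta>_def by linarith
  qed
  finally have out: "accept_prob orc (trial n k r (D r) out) \<le> 1 - \<delta>" .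
  let ?a = "\<lambda>b. accept_prob orc (trial n k r (D r) b)"
  have "?a True * ?a False \<le> ?a out"
    using accept_prob_nonneg accept_prob_le_1 by (cases out) (auto intro: mult_left_le mult_left_le_one_le)
  then have "?a True * ?a False \<le> 1 - \<delta>" using out by simp
  moreover have "2 \<le> \<delta> * num_samples s j"
  proof -
    have "6 * s * J / 2 ^ j \<le> num_samples s j" unfolding num_samples_def J_def by linarith
    then have "\<delta> * (6 * s * J / 2 ^ j) \<le> \<delta> * num_samples s j"
      using s(2) by (intro mult_left_mono) (auto simp: \<delta>_def)
    moreover have "\<delta> * (6 * s * J / 2 ^ j) = 9 / 4" using s(2) j by (simp add: \<delta>_def field_simps)
    ultimately show ?thesis by simp
  qed
  ultimately have "accept_prob orc (scale_tester n k s D j) \<le> 1 / 3"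
    unfolding accept_prob_scale_tester r_def[symmetric]
    by (intro power_one_minus_le_third[of _ \<delta>] mult_nonneg_nonneg accept_prob_nonneg)
  moreover have "accept_prob orc (sampling_tester n k s D) \<le> accept_prob orc (scale_tester n k s D j)"
    unfolding sampling_tester_def accept_prob_run_all
    by (rule prod_list_le_member) (use j in \<open>auto simp: accept_prob_nonneg accept_prob_le_1 J_def\<close>)
  ultimately show ?thesis by simp
qed

lemma connectivity_tester_one_sided:
  assumes "k_vertex_connected k G"
  shows "accept_prob orc (connectivity_tester n k t D D') = 1"
proof -
  have "k < n" using assms G(2) by (simp add: k_vertex_connected_def)
  then show ?thesis
    using read_all_exact sampling_tester_one_sided[OF assms] assms
    by (simp add: connectivity_tester_def Let_def)
qed

lemma connectivity_tester_rejects: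
  assumes "0 \<le> t" and far: "needs_more_modifications (k_vertex_connected k) t G"
  shows "accept_prob orc (connectivity_tester n k t D D') \<le> 1 / 3"
proof (cases "n \<le> k")
  case False
  then have "k < n" by simp
  \<comment> \<open>Zero modifications do not exceed t, so a far graph lacks the property and exact
    reading rejects it.\<close>
  have "\<not> k_vertex_connected k G"
  proof
    assume "k_vertex_connected k G"
    then have "t < real (modifications G G)"
      using far G(1) by (simp add: needs_more_modifications_def)
    then show False using assms(1) by (simp add: modifications_def)
  qed
  define s where "s = 4 * real k * real n / t"
  \<comment> \<open>A far graph with \<open>s < 1\<close> would have more than n disjoint nonempty
    sets of vertices, so accepting when \<open>s < 1\<close> never meets a far graph.\<close>
  have "\<not> s < 1" if t: "68 * (real k)\<^sup>2 \<le> t"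
  proof
    assume "s < 1"
    have "0 < t" using t k by (auto intro: less_le_trans[rotated])
    then have "real n < t / (4 * k)" using \<open>s < 1\<close> k by (simp add: s_def field_simps)
    moreover have "2 * (real k)\<^sup>2 \<le> t" using t zero_le_power2[of "real k"] by linarith
    then have "\<exists>\<X>. disjoint \<X> \<and> \<X> \<subseteq> Pow {..<n} - {{}} \<and> t / (4 * k) \<le> card \<X>"
      using many_small_cuts_if_far[OF \<open>k < n\<close> _ far] by blast
    ultimately show False using card_disjoint_nonempty_le by (metis leD of_nat_le_iff order_less_le_trans)
  qed
  moreover have "accept_prob orc (sampling_tester n k s D) \<le> 1 / 3"
    if "68 * (real k)\<^sup>2 \<le> t" "\<not> s < 1"
    using sampling_tester_rejects[OF \<open>k < n\<close> that(1) s_def _ far] that(2) by simp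
  ultimately show ?thesis
    using False read_all_exact \<open>\<not> k_vertex_connected k G\<close>
    by (auto simp: connectivity_tester_def Let_def simp flip: s_def)
qed (simp add: connectivity_tester_def)

end

section \<open>Query bounds and the degree budgets of the two models\<close>

lemma connectivity_tester_queries:
  assumes "1 \<le> k" "0 \<le> B"
    and "k < n \<Longrightarrow> t < 68 * (real k)\<^sup>2 \<Longrightarrow> real n * real D' \<le> B"
    and "\<And>s. 68 * (real k)\<^sup>2 \<le> t \<Longrightarrow> s = 4 * real k * real n / t \<Longrightarrow> 1 \<le> s \<Longrightarrow>
      288 * (real k)\<^sup>2 * s * num_scales s * (\<Sum>j<num_scales s. real (D (2 ^ Suc j))) \<le> B"
  shows "\<forall>(b, c) \<in> set_pmf (run orc (connectivity_tester n k t D D')). real c \<le> B"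
proof -
  define s where "s = 4 * real k * real n / t"
  have *: "\<forall>(b, c) \<in> set_pmf (run orc A). real c \<le> B" if "max_queries orc A q" "real q \<le> B" for A q
    using that unfolding max_queries_def by fastforce
  consider "n \<le> k" | "k < n" "t < 68 * (real k)\<^sup>2" | "k < n" "68 * (real k)\<^sup>2 \<le> t" "s < 1"
    | "k < n" "68 * (real k)\<^sup>2 \<le> t" "1 \<le> s" by linarith
  then show ?thesis
  proof cases
    case 2
    have "max_queries orc (read_all n k D' [0..<n] {}) (n * D')"
      using max_queries_read_all[of orc n k D' "[0..<n]"] by simp
    moreover have "real (n * D') \<le> B" using 2 assms(3) by simp
    ultimately have "\<forall>(b, c) \<in> set_pmf (run orc (read_all n k D' [0..<n] {})). real c \<le> B"
      by (rule *)
    then show ?thesis using 2 by (simp add: connectivity_tester_def)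
  next
    case 4
    obtain q where "max_queries orc (sampling_tester n k s D) q"
      "q \<le> 288 * (real k)\<^sup>2 * s * num_scales s * (\<Sum>j<num_scales s. real (D (2 ^ Suc j)))"
      using max_queries_sampling_tester[OF assms(1) 4(3)] by blast
    with 4 assms(4)[OF 4(2) s_def 4(3)] show ?thesis
      by (simp add: connectivity_tester_def Let_def not_less flip: s_def) (rule *, auto)
  qed (use assms(2) in \<open>simp_all add: connectivity_tester_def Let_def flip: s_def\<close>)
qed

text \<open>The bound \<open>log 2 (16 * y)\<close> splits into \<open>4 + log 2 y\<close>. As
  \<open>2 * ln 2 \<ge> 1\<close>, the logarithm is at most \<open>2 * olog y\<close>, and 4 is
  absorbed because \<open>olog y \<ge> 1\<close>.\<close>

lemma num_scales_le_olog:
  assumes "1 \<le> 4 * y"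
  shows "num_scales (4 * y) \<le> 6 * olog y"
proof -
  have "0 < y" using assms by simp
  have "log 2 (2 ^ 4 * y) = log 2 (2 ^ 4) + log 2 y"
    using \<open>0 < y\<close> by (subst log_mult) auto
  also have "log 2 (2 ^ 4) = (4 :: real)" by (subst log_nat_power) auto
  finally have "num_scales (4 * y) \<le> 4 + log 2 y"
    using num_scales_bounds(1)[OF assms] by simp
  also have "log 2 y \<le> 2 * olog y"
  proof -
    have "ln y \<le> olog y" "0 \<le> olog y" by (auto simp: olog_def)
    then have "ln y \<le> 2 * ln 2 * olog y"
      using ln2_ge_two_thirds mult_right_mono[of 1 "2 * ln 2" "olog y"] by simp
    then show ?thesis by (simp add: log_def field_simps)
  qed
  also have "4 + 2 * olog y \<le> 6 * olog y" by (simp add: olog_def)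
  finally show ?thesis by simp
qed

lemma card_Image_le_out_degree:
  assumes "pair_digraph G"
  shows "card (parcs G `` {v}) \<le> out_degree (with_proj G) v"
proof -
  interpret pair_digraph G by fact
  have "parcs G `` {v} = snd ` out_arcs (with_proj G) v" by (force simp: image_iff)
  then show ?thesis
    unfolding out_degree_def by (metis card_image_le finite_out_arcs)
qed

lemma card_Image_converse_le_in_degree:
  assumes "pair_digraph G"
  shows "card ((parcs G)\<inverse> `` {v}) \<le> in_degree (with_proj G) v"
proof -
  interpret pair_digraph G by fact
  have "(parcs G)\<inverse> `` {v} = fst ` in_arcs (with_proj G) v" by (force simp: image_iff)
  then show ?thesis
    unfolding in_degree_def by (metis card_image_le finite_in_arcs)
qed

text \<open>All neighbours of a vertex of X lie in X or in \<open>N(X)\<close>, so its degree is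
  below \<open>r + k\<close> although no degree bound is given.\<close>

lemma tester_input_unbounded:
  assumes "graph_with_edges n m G" "incidence_oracle G orc" "1 \<le> k"
  shows "tester_input G orc n k (\<lambda>r. r + k) (n + 1)"
proof (rule tester_input.intro)
  show G: "pair_digraph G" "pverts G = {..<n}"
    using assms(1) by (simp_all add: graph_with_edges_def)
  interpret pair_digraph G by fact
  have sub: "parcs G \<subseteq> {..<n} \<times> {..<n}" using in_arcsD1 in_arcsD2 G(2) by auto
  fix v
  have "card (parcs G `` {v}) \<le> card {..<n}" by (rule card_mono) (use sub in auto)
  then show "card (parcs G `` {v}) < n + 1" by simp
next
  fix r out X v
  assume X: "X \<subseteq> {..<n}" "card (nbrs (orient out (parcs G)) X) < k" "v \<in> X" "card X \<le> r"
  have "pair_digraph G" using assms(1) by (simp add: graph_with_edges_def)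
  then interpret pair_digraph G .
  let ?E = "orient out (parcs G)"
  have "finite ?E" using pair_finite_arcs by (simp add: orient_def)
  have "finite X" using X(1) finite_subset by blast
  have "card (?E `` {v}) \<le> card (X \<union> nbrs ?E X)"
    by (rule card_mono, use \<open>finite X\<close> finite_nbrs[OF \<open>finite ?E\<close>] in simp)
      (use X(3) in \<open>auto simp: nbrs_def\<close>)
  also have "\<dots> \<le> card X + card (nbrs ?E X)" by (rule card_Un_le)
  finally show "card (?E `` {v}) < r + k" using X(2,4) by simp
qed (use assms in auto)

lemma tester_input_bounded:
  assumes "graph_with_degree_bound n d G" "incidence_oracle G orc" "1 \<le> k"
  shows "tester_input G orc n k (\<lambda>_. d + 1) (d + 1)"
proof (rule tester_input.intro)
  show G: "pair_digraph G" "pverts G = {..<n}"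
    using assms(1) by (simp_all add: graph_with_degree_bound_def)
  interpret pair_digraph G by fact
  have sub: "parcs G \<subseteq> {..<n} \<times> {..<n}" using in_arcsD1 in_arcsD2 G(2) by auto
  have deg: "card (parcs G `` {v}) \<le> d" "card ((parcs G)\<inverse> `` {v}) \<le> d" if "v < n" for v
    using card_Image_le_out_degree[OF G(1), of v] card_Image_converse_le_in_degree[OF G(1), of v]
      assms(1) that by (auto simp: graph_with_degree_bound_def intro: order_trans)
  fix v
  show "card (parcs G `` {v}) < d + 1"
  proof (cases "v < n")
    case False
    then have "parcs G `` {v} = {}" using sub by auto
    then show ?thesis by simp
  qed (use deg in \<open>simp add: less_Suc_eq_le\<close>)
  fix out X u assume "X \<subseteq> {..<n}" "u \<in> X"
  then show "card (orient out (parcs G) `` {u}) < d + 1"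
    using deg[of u] by (auto simp: orient_def less_Suc_eq_le)
qed (use assms in auto)

lemma property_tester_and_one_sided:
  assumes "\<And>G orc. I G \<Longrightarrow> incidence_oracle G orc \<Longrightarrow> P G \<Longrightarrow> accept_prob orc A = 1"
    and "\<And>G orc. I G \<Longrightarrow> incidence_oracle G orc \<Longrightarrow> F G \<Longrightarrow> accept_prob orc A \<le> 1 / 3"
  shows "property_tester I P F A \<and> one_sided I P A \<and> false_reject_at_most I P (1 / 3) A"
  using assms unfolding property_tester_def one_sided_def false_reject_at_most_def reject_prob_eq
  by fastforce

text \<open>In terms of y the target is \<open>k ^ 3 * y ^ 2 * olog y\<close>. The degree budgets
  sum to at most \<open>48 * y * k\<close>, being a geometric sum plus \<open>J * k\<close> with
  \<open>J \<le> 16 * y\<close>, so only the factor \<open>num_scales\<close> yields a logarithm.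
  The constant is \<open>288 * 4 * 6 * 48\<close>.\<close>

lemma unbounded_query_bound:
  fixes e :: real and n k :: nat
  defines "y \<equiv> real k / e"
  assumes "0 < e" "1 \<le> k"
  shows "real n * e < 68 * (real k)\<^sup>2 \<Longrightarrow> k < n \<Longrightarrow>
      real n * real (n + 1) \<le> 331776 * (real k ^ 5 / e\<^sup>2 * olog y)"
    and "1 \<le> 4 * y \<Longrightarrow>
      288 * (real k)\<^sup>2 * (4 * y) * num_scales (4 * y) *
        (\<Sum>j<num_scales (4 * y). real (2 ^ Suc j + k)) \<le> 331776 * (real k ^ 5 / e\<^sup>2 * olog y)"
proof -
  have y: "0 < y" "real k ^ 5 / e\<^sup>2 = real k ^ 3 * y\<^sup>2"
    using assms by (auto simp: y_def power_divide power_add[symmetric] eval_nat_numeral)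
  have olog: "1 \<le> olog y" by (simp add: olog_def)
  show "real n * real (n + 1) \<le> 331776 * (real k ^ 5 / e\<^sup>2 * olog y)"
    if "real n * e < 68 * (real k)\<^sup>2" "k < n"
  proof -
    have "real n \<le> 68 * real k * y" using that(1) assms(2) by (simp add: y_def field_simps power2_eq_square)
    then have "real n * real n \<le> (68 * real k * y) * (68 * real k * y)"
      using y(1) by (intro mult_mono) auto
    moreover have "real n \<le> real n * real n" using that(2) by simp
    ultimately have "real n * real (n + 1) \<le> 9248 * ((real k)\<^sup>2 * y\<^sup>2)"
      by (simp add: algebra_simps power2_eq_square)
    also have "\<dots> \<le> 331776 * (real k ^ 3 * y\<^sup>2)"
      using assms(3) y(1) power_increasing[of 2 3 "real k"]
      by (intro mult_mono) auto
    also have "\<dots> \<le> 331776 * (real k ^ 3 * y\<^sup>2 * olog y)"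
      using olog mult_left_mono[of 1 "olog y" "real k ^ 3 * y\<^sup>2"] by simp
    finally show ?thesis unfolding y(2) .
  qed
  show "288 * (real k)\<^sup>2 * (4 * y) * num_scales (4 * y) *
        (\<Sum>j<num_scales (4 * y). real (2 ^ Suc j + k)) \<le> 331776 * (real k ^ 5 / e\<^sup>2 * olog y)"
    if "1 \<le> 4 * y"
  proof -
    define J where "J = num_scales (4 * y)"
    have J: "2 ^ J \<le> 16 * y" using num_scales_bounds(2)[OF that] by (simp add: J_def)
    have "real J \<le> 2 ^ J" using less_exp[of J] by (metis less_imp_le of_nat_le_iff of_nat_numeral of_nat_power)
    have "(\<Sum>j<J. real (2 ^ Suc j + k)) = 2 * (\<Sum>j<J. 2 ^ j :: real) + real (J * k)"
      by (simp add: sum.distrib sum_distrib_left)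
    also have "(\<Sum>j<J. 2 ^ j) = (2 ^ J - 1 :: real)" by (induction J) auto
    also have "2 * (2 ^ J - 1) + real (J * k) \<le> 2 * (16 * y) * k + (16 * y) * k"
    proof (rule add_mono)
      have "2 * (2 ^ J - 1) \<le> 2 * (16 * y) * 1" using J by simp
      also have "\<dots> \<le> 2 * (16 * y) * k" using assms(3) y(1) by (intro mult_left_mono) auto
      finally show "2 * (2 ^ J - 1) \<le> 2 * (16 * y) * k" .
      have "real J \<le> 16 * y" using J \<open>real J \<le> 2 ^ J\<close> by linarith
      then show "real (J * k) \<le> (16 * y) * k" by (simp add: mult_right_mono)
    qed
    also have "\<dots> = 48 * y * k" by simp
    finally have S: "(\<Sum>j<J. real (2 ^ Suc j + k)) \<le> 48 * y * k" .
    have "288 * (real k)\<^sup>2 * (4 * y) * J * (\<Sum>j<J. real (2 ^ Suc j + k))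
        \<le> 288 * (real k)\<^sup>2 * (4 * y) * (6 * olog y) * (48 * y * k)"
      using num_scales_le_olog[OF that] S y(1) olog
      by (intro mult_mono mult_nonneg_nonneg sum_nonneg) (auto simp: J_def)
    also have "\<dots> = 331776 * (real k ^ 3 * y\<^sup>2 * olog y)"
      by (simp add: power2_eq_square power3_eq_cube)
    finally show ?thesis unfolding y(2) J_def .
  qed
qed

text \<open>All degree budgets are equal, so summing over the scales gives a second logarithm, while
  \<open>y * d = k / \<epsilon>\<close> removes the degree. The constant is
  \<open>288 * 4 * 6 * 6 * 2\<close>, the last factor from \<open>d + 1 \<le> 2 * d\<close>.\<close>

lemma bounded_query_bound:
  fixes \<epsilon> :: real and n k d :: nat
  defines "y \<equiv> real k / (\<epsilon> * real d)"
  assumes "0 < \<epsilon>" "1 \<le> k" "0 < d"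
  shows "real n * (\<epsilon> * d) < 68 * (real k)\<^sup>2 \<Longrightarrow>
      real n * real (d + 1) \<le> 82944 * (real k ^ 3 / \<epsilon> * (olog y)\<^sup>2)"
    and "1 \<le> 4 * y \<Longrightarrow>
      288 * (real k)\<^sup>2 * (4 * y) * num_scales (4 * y) *
        (\<Sum>j<num_scales (4 * y). real (d + 1)) \<le> 82944 * (real k ^ 3 / \<epsilon> * (olog y)\<^sup>2)"
proof -
  have olog: "1 \<le> olog y" by (simp add: olog_def)
  have yd: "y * d = k / \<epsilon>" "0 < y" using assms by (auto simp: y_def)
  show "real n * real (d + 1) \<le> 82944 * (real k ^ 3 / \<epsilon> * (olog y)\<^sup>2)"
    if "real n * (\<epsilon> * d) < 68 * (real k)\<^sup>2"
  proof -
    have "real n * real (d + 1) \<le> real n * (2 * d)" using assms(4) by (intro mult_left_mono) auto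
    also have "\<dots> \<le> 136 * ((real k)\<^sup>2 / \<epsilon>)" using that assms(2) by (simp add: field_simps)
    also have "\<dots> \<le> 82944 * ((real k ^ 3 / \<epsilon>) * 1)"
      using assms(2,3) power_increasing[of 2 3 "real k"]
      by (intro mult_mono) (auto intro: divide_right_mono)
    also have "\<dots> \<le> 82944 * ((real k ^ 3 / \<epsilon>) * (olog y)\<^sup>2)"
      using olog assms(2) by (intro mult_left_mono) auto
    finally show ?thesis by simp
  qed
  show "288 * (real k)\<^sup>2 * (4 * y) * num_scales (4 * y) *
        (\<Sum>j<num_scales (4 * y). real (d + 1)) \<le> 82944 * (real k ^ 3 / \<epsilon> * (olog y)\<^sup>2)"
    if "1 \<le> 4 * y"
  proof -
    define J where "J = num_scales (4 * y)"
    have J: "real J \<le> 6 * olog y" using num_scales_le_olog[OF that] by (simp add: J_def)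
    have "288 * (real k)\<^sup>2 * (4 * y) * J * (\<Sum>j<J. real (d + 1))
        = 288 * (real k)\<^sup>2 * (4 * y) * J * (J * real (d + 1))" by simp
    also have "\<dots> \<le> 288 * (real k)\<^sup>2 * (4 * y) * (6 * olog y) * ((6 * olog y) * (2 * d))"
      using J yd(2) olog assms(4) by (intro mult_mono mult_nonneg_nonneg) auto
    also have "\<dots> = 82944 * ((real k)\<^sup>2 * (y * d) * (olog y)\<^sup>2)"
      by (simp add: power2_eq_square)
    also have "(real k)\<^sup>2 * (y * d) = real k ^ 3 / \<epsilon>"
      unfolding yd(1) by (simp add: power2_eq_square power3_eq_cube)
    finally show ?thesis unfolding J_def .
  qed
qed

lemma unbounded_degree_tester:
  fixes \<epsilon> davg :: real and n m k :: nat
  assumes "0 < \<epsilon>" "1 \<le> k" "davg = real m / real n"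
  defines "A \<equiv> connectivity_tester n k (\<epsilon> * real n * (real m / real n)) (\<lambda>r. r + k) (n + 1)"
  shows "property_tester (graph_with_edges n m) (k_vertex_connected k)
            (needs_more_modifications (k_vertex_connected k) (\<epsilon> * real n * davg)) A \<and>
          one_sided (graph_with_edges n m) (k_vertex_connected k) A \<and>
          false_reject_at_most (graph_with_edges n m) (k_vertex_connected k) (1/3) A \<and>
          (0 < m \<longrightarrow>
             queries_at_most (graph_with_edges n m)
               (331776 * (real k ^ 5 / (\<epsilon> * davg)\<^sup>2 * olog (real k / (\<epsilon> * davg)))) A)"
proof -
  define t where "t = \<epsilon> * real n * davg"
  have A: "A = connectivity_tester n k t (\<lambda>r. r + k) (n + 1)"
    by (simp add: A_def t_def assms(3))
  have "0 \<le> t" using assms by (simp add: t_def)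
  have "property_tester (graph_with_edges n m) (k_vertex_connected k)
      (needs_more_modifications (k_vertex_connected k) t) A \<and>
    one_sided (graph_with_edges n m) (k_vertex_connected k) A \<and>
    false_reject_at_most (graph_with_edges n m) (k_vertex_connected k) (1/3) A"
  proof (rule property_tester_and_one_sided)
    fix G orc assume "graph_with_edges n m G" "incidence_oracle G orc"
    then interpret tester_input G orc n k "\<lambda>r. r + k" "n + 1"
      using assms(2) by (rule tester_input_unbounded)
    show "accept_prob orc A = 1" if "k_vertex_connected k G"
      unfolding A using that by (rule connectivity_tester_one_sided)
    show "accept_prob orc A \<le> 1 / 3" if "needs_more_modifications (k_vertex_connected k) t G"
      unfolding A using \<open>0 \<le> t\<close> that by (rule connectivity_tester_rejects)
  qed
  moreover have "queries_at_most (graph_with_edges n m)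
      (331776 * (real k ^ 5 / (\<epsilon> * davg)\<^sup>2 * olog (real k / (\<epsilon> * davg)))) A" if "0 < m"
    unfolding queries_at_most_def A
  proof (intro allI impI connectivity_tester_queries[OF assms(2)])
    define e where "e = \<epsilon> * davg"
    have t: "t = real n * e" by (simp add: t_def e_def)
    \<comment> \<open>For \<open>n = 0\<close> the quotient \<open>m / n\<close> is 0, so positivity
      of e is claimed only when there is a vertex.\<close>
    have e: "0 < e" if "0 < n" using that \<open>0 < m\<close> assms(1,3) by (simp add: e_def)
    have "0 \<le> olog (real k / e)" by (simp add: olog_def)
    then show "0 \<le> 331776 * (real k ^ 5 / (\<epsilon> * davg)\<^sup>2 * olog (real k / (\<epsilon> * davg)))"
      unfolding e_def[symmetric] by (intro mult_nonneg_nonneg divide_nonneg_nonneg) auto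
    show "real n * real (n + 1) \<le> 331776 * (real k ^ 5 / (\<epsilon> * davg)\<^sup>2 * olog (real k / (\<epsilon> * davg)))"
      if "k < n" "t < 68 * (real k)\<^sup>2"
      unfolding e_def[symmetric] by (rule unbounded_query_bound) (use e that assms(2) t in auto)
    fix s assume s: "68 * (real k)\<^sup>2 \<le> t" "s = 4 * real k * real n / t" "1 \<le> s"
    have "0 < n" using s by (auto intro: gr0I)
    then have "s = 4 * (real k / e)" using s(2) e by (simp add: t)
    then show "288 * (real k)\<^sup>2 * s * num_scales s * (\<Sum>j<num_scales s. real (2 ^ Suc j + k))
      \<le> 331776 * (real k ^ 5 / (\<epsilon> * davg)\<^sup>2 * olog (real k / (\<epsilon> * davg)))"
      unfolding e_def[symmetric]
      using unbounded_query_bound(2)[OF e[OF \<open>0 < n\<close>] assms(2)] s(3) by simp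
  qed
  ultimately show ?thesis unfolding t_def by blast
qed

lemma bounded_degree_tester:
  fixes \<epsilon> :: real and n d k :: nat
  assumes "0 < \<epsilon>" "1 \<le> k"
  defines "A \<equiv> connectivity_tester n k (\<epsilon> * real n * real d) (\<lambda>_. d + 1) (d + 1)"
  shows "property_tester (graph_with_degree_bound n d) (k_vertex_connected k)
            (needs_more_modifications (k_vertex_connected k) (\<epsilon> * real n * real d)) A \<and>
          one_sided (graph_with_degree_bound n d) (k_vertex_connected k) A \<and>
          false_reject_at_most (graph_with_degree_bound n d) (k_vertex_connected k) (1/3) A \<and>
          (0 < d \<longrightarrow>
             queries_at_most (graph_with_degree_bound n d)
               (82944 * (real k ^ 3 / \<epsilon> * (olog (real k / (\<epsilon> * real d)))\<^sup>2)) A)"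
proof -
  define t where "t = \<epsilon> * real n * real d"
  have A: "A = connectivity_tester n k t (\<lambda>_. d + 1) (d + 1)"
    by (simp add: A_def t_def)
  have "0 \<le> t" using assms by (simp add: t_def)
  have "property_tester (graph_with_degree_bound n d) (k_vertex_connected k)
      (needs_more_modifications (k_vertex_connected k) t) A \<and>
    one_sided (graph_with_degree_bound n d) (k_vertex_connected k) A \<and>
    false_reject_at_most (graph_with_degree_bound n d) (k_vertex_connected k) (1/3) A"
  proof (rule property_tester_and_one_sided)
    fix G orc assume "graph_with_degree_bound n d G" "incidence_oracle G orc"
    then interpret tester_input G orc n k "\<lambda>_. d + 1" "d + 1"
      using assms(2) by (rule tester_input_bounded)
    show "accept_prob orc A = 1" if "k_vertex_connected k G"
      unfolding A using that by (rule connectivity_tester_one_sided)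
    show "accept_prob orc A \<le> 1 / 3" if "needs_more_modifications (k_vertex_connected k) t G"
      unfolding A using \<open>0 \<le> t\<close> that by (rule connectivity_tester_rejects)
  qed
  moreover have "queries_at_most (graph_with_degree_bound n d)
      (82944 * (real k ^ 3 / \<epsilon> * (olog (real k / (\<epsilon> * real d)))\<^sup>2)) A" if "0 < d"
    unfolding queries_at_most_def A
  proof (intro allI impI connectivity_tester_queries[OF assms(2)])
    show "0 \<le> 82944 * (real k ^ 3 / \<epsilon> * (olog (real k / (\<epsilon> * real d)))\<^sup>2)"
      using assms(1) by simp
    show "real n * real (d + 1) \<le> 82944 * (real k ^ 3 / \<epsilon> * (olog (real k / (\<epsilon> * real d)))\<^sup>2)"
      if "t < 68 * (real k)\<^sup>2"
      by (rule bounded_query_bound) (use that assms \<open>0 < d\<close> in \<open>auto simp: t_def ac_simps\<close>)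
    fix s assume s: "68 * (real k)\<^sup>2 \<le> t" "s = 4 * real k * real n / t" "1 \<le> s"
    have "0 < n" using s by (auto intro: gr0I)
    then have "s = 4 * (real k / (\<epsilon> * real d))" using s(2) by (simp add: t_def)
    then show "288 * (real k)\<^sup>2 * s * num_scales s * (\<Sum>j<num_scales s. real (d + 1))
      \<le> 82944 * (real k ^ 3 / \<epsilon> * (olog (real k / (\<epsilon> * real d)))\<^sup>2)"
      using bounded_query_bound(2)[OF assms(1,2) \<open>0 < d\<close>] s(3) by simp
  qed
  ultimately show ?thesis unfolding t_def by blast
qed

theorem theorem30:
  shows
    "(\<exists>(A :: nat \<Rightarrow> nat \<Rightarrow> real \<Rightarrow> nat \<Rightarrow> algorithm) (C :: real). 0 < C \<and>
       (\<forall>(n :: nat) (m :: nat) (\<epsilon> :: real) (k :: nat) (davg :: real).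
          0 < \<epsilon> \<longrightarrow> 1 \<le> k \<longrightarrow> davg = real m / real n \<longrightarrow>
          property_tester (graph_with_edges n m) (k_vertex_connected k)
            (needs_more_modifications (k_vertex_connected k) (\<epsilon> * real n * davg)) (A n m \<epsilon> k) \<and>
          one_sided (graph_with_edges n m) (k_vertex_connected k) (A n m \<epsilon> k) \<and>
          false_reject_at_most (graph_with_edges n m) (k_vertex_connected k) (1/3) (A n m \<epsilon> k) \<and>
          (0 < m \<longrightarrow>
             queries_at_most (graph_with_edges n m)
               (C * (real k ^ 5 / (\<epsilon> * davg)\<^sup>2 * olog (real k / (\<epsilon> * davg)))) (A n m \<epsilon> k))))
     \<and>
     (\<exists>(A :: nat \<Rightarrow> nat \<Rightarrow> real \<Rightarrow> nat \<Rightarrow> algorithm) (C :: real). 0 < C \<and>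
       (\<forall>(n :: nat) (d :: nat) (\<epsilon> :: real) (k :: nat).
          0 < \<epsilon> \<longrightarrow> 1 \<le> k \<longrightarrow>
          property_tester (graph_with_degree_bound n d) (k_vertex_connected k)
            (needs_more_modifications (k_vertex_connected k) (\<epsilon> * real n * real d)) (A n d \<epsilon> k) \<and>
          one_sided (graph_with_degree_bound n d) (k_vertex_connected k) (A n d \<epsilon> k) \<and>
          false_reject_at_most (graph_with_degree_bound n d) (k_vertex_connected k) (1/3) (A n d \<epsilon> k) \<and>
          (0 < d \<longrightarrow>
             queries_at_most (graph_with_degree_bound n d)
               (C * (real k ^ 3 / \<epsilon> * (olog (real k / (\<epsilon> * real d)))\<^sup>2)) (A n d \<epsilon> k))))"
proof (rule conjI, goal_cases)
  case 1
  show ?case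
    using unbounded_degree_tester
    by (intro exI[of _ "\<lambda>n m \<epsilon> k. connectivity_tester n k (\<epsilon> * real n * (real m / real n)) (\<lambda>r. r + k) (n + 1)"]
        exI[of _ "331776 :: real"]) simp
next
  case 2
  show ?case
    using bounded_degree_tester
    by (intro exI[of _ "\<lambda>n d \<epsilon> k. connectivity_tester n k (\<epsilon> * real n * real d) (\<lambda>_. d + 1) (d + 1)"]
        exI[of _ "82944 :: real"]) simp
qed

end
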